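(* Let $\mathscr G=(X,\mathcal L)$ be an interval greedoid, let $1\le k<\mathrm{rk}(\mathscr G)$, and let $q:\mathcal L\to\mathbb R_{>0}$ be a $k$-admissible weight function. Then $$\mathrm L_q(k)^2\ =\ \mathrm L_q(k-1)\cdot\mathrm L_q(k+1)$$ if and only if there is a constant $s>0$ such that for every $\alpha\in\mathcal L$ with $|\alpha|=k-1$ we have $$\mathrm L_{q,\alpha}(2)\ =\ s\,\mathrm L_{q,\alpha}(1)\ =\ s^2\,\mathrm L_{q,\alpha}(0).$$ Here $\mathrm L_{q,\alpha}(j)=\sum_{\beta\in\mathrm{Cont}_j(\alpha)}q(\alpha\beta)$ and $\mathrm L_q(j)=\sum_{\alpha\in\mathcal L,\,|\alpha|=j}q(\alpha)$.
   Context: **Greedoids.** Let $X$ be a finite set, $X^*$ the set of finite words in $X$; a word is simple if no letter repeats; $|\alpha|$ is the length of $\alpha$. A greedoid is a pair $\mathscr G=(X,\mathcal L)$ with $\mathcal L\subset X^*$ finite such that: the empty word is in $\mathcal L$; every $\alpha\in\mathcal L$ is simple; $\alpha\beta\in\mathcal L\Rightarrow\alpha\in\mathcal L$; and if $\alpha,\beta\in\mathcal L$ with $|\alpha|>|\beta|$ then there is a letter $x$ of $\alpha$ with $\beta x\in\mathcal L$. $\mathrm{rk}(\mathscr G)=\max\{|\alpha|:\alpha\in\mathcal L\}$. It is an interval greedoid if moreover for all $\alpha,\beta,\gamma\in X^*$, $x\in X$: $\alpha x,\ \alpha\beta\gamma x\in\mathcal L\Rightarrow\alpha\beta x\in\mathcal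 L$. **Notation.** For $\alpha\in\mathcal L$: $\mathrm{Cont}_r(\alpha)=\{\beta\in X^*:|\beta|=r,\ \alpha\beta\in\mathcal L\}$, $\mathrm{Cont}(\alpha)=\mathrm{Cont}_1(\alpha)$ (and these sets are empty if $\alpha\notin\mathcal L$). On $\mathrm{Cont}(\alpha)$ the relation $x\sim_\alpha y\iff\alpha xy\notin\mathcal L$ is an equivalence relation; $\mathrm{Par}(\alpha)$ is the set of its classes. For $x\in\mathrm{Cont}(\alpha)$, $\mathrm{Des}_\alpha(x)=\{y\in X:\alpha xy\in\mathcal L,\ \alpha y\notin\mathcal L\}$. For $x,y\in X$, $\mathrm{Pas}_\alpha(x,y)=\{z\in X:\alpha z\notin\mathcal L,\ \alpha xz\notin\mathcal L,\ \alpha yz\notin\mathcal L,\ \alpha xyz\in\mathcal L\}$, $\mathrm{Act}_\alpha(x,y)=\{z\in X:\alpha z\notin\mathcal L,\ \alpha xz\in\mathcal L,\ \alpha yz\in\mathcal L,\ \alpha xyz\in\mathcal L\}$. **$k$-admissible.** Let $m=\mathrm{rk}(\mathscr G)$ and $1\le k<m$. Extend $q:\mathcal L\to\mathbb R_{>0}$ to $X^*$ by $0$ outside $\mathcal L$. $q$ is $k$-admissible if there is a scale sequence $(c_0,\dots,c_m)\in\mathbb R_{>0}^{m+1}$ such that, with $\omega(\alpha):=q(\alpha)/c_{|\alpha|}$, the following hold for every $\alpha\in\mathcal L$ with $\ell:=|\alpha|<k$: 1. (ContInv) $q(\alpha xy\beta)=q(\alpha yx\beta)$ for all $x,y\in\mathrm{Cont}(\alpha)$,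 $\beta\in X^*$. 2. (PAMon) for all distinct $x,y\in\mathrm{Cont}(\alpha)$ and all $r\ge0$: $\sum_{z\in\mathrm{Pas}_\alpha(x,y)}\sum_{\beta\in\mathrm{Cont}_r(\alpha xyz)}q(\alpha xyz\beta)\ \ge\ \sum_{z\in\mathrm{Act}_\alpha(x,y)}\sum_{\beta\in\mathrm{Cont}_r(\alpha xyz)}q(\alpha xyz\beta)$. 3. (LogMod) $\omega(\alpha x)\,\omega(\alpha y)=\omega(\alpha)\,\omega(\alpha xy)$ for all $x,y\in\mathrm{Cont}(\alpha)$ with $\alpha xy\in\mathcal L$. 4. (FewDes) for every $\mathcal C\in\mathrm{Par}(\alpha)$ with $|\mathcal C|\ge2$ and every $x\in\mathcal C$: $\mathrm{Des}_\alpha(x)=\varnothing$. 5. (SynMon) $\omega(\alpha x)^2\ge\sum_{y\in\mathrm{Des}_\alpha(x)}\omega(\alpha)\,\omega(\alpha xy)$ for all $x\in\mathrm{Cont}(\alpha)$. 6. (ScaleMon) $\Bigl(1-\frac{c_{\ell+1}^2}{c_\ell c_{\ell+2}}\Bigr)\sum_{\mathcal C\in\mathrm{Par}(\alpha)}\frac{1}{1-b_\alpha(\mathcal C)}\le1$, where $b_\alpha(\mathcal C)=\sum_{y\in\mathrm{Des}_\alpha(x)}\frac{\omega(\alpha)\omega(\alpha xy)}{\omega(\alpha x)^2}$ if $\mathcal C=\{x\}$ and $b_\alpha(\mathcal C)=0$ if $|\mathcal C|\ge2$. Convention: this is considered satisfied whenever $c_{\ell+1}^2\ge c_\ell c_{\ell+2}$;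 and when $c_{\ell+1}^2<c_\ell c_{\ell+2}$ it includes the requirement $b_\alpha(\mathcal C)<1$ for all $\mathcal C\in\mathrm{Par}(\alpha)$. *)

theory Defs
  imports Complex_Main
begin

text \<open>
  A word over \<open>X\<close> is a list in \<open>lists X\<close>, and a letter \<open>x\<close> is identified with the word \<open>[x]\<close>.
\<close>

locale greedoid =
  fixes X :: "'a set" and L :: "'a list set"
  assumes finite_ground: "finite X"
    and finite_words: "finite L"
    and words_over: "L \<subseteq> lists X"
    and nil_word: "[] \<in> L"
    and simple: "\<alpha> \<in> L \<Longrightarrow> distinct \<alpha>"
    and hereditary: "\<alpha> @ \<beta> \<in> L \<Longrightarrow> \<alpha> \<in> L"
    and exchange: "\<alpha> \<in> L \<Longrightarrow> \<beta> \<in> L \<Longrightarrow> length \<alpha> > length \<beta> \<Longrightarrow> \<exists>x\<in>set \<alpha>. \<beta> @ [x] \<in> L"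

locale interval_greedoid = greedoid +
  assumes interval:
    "\<alpha> \<in> lists X \<Longrightarrow> \<beta> \<in> lists X \<Longrightarrow> \<gamma> \<in> lists X \<Longrightarrow> x \<in> X \<Longrightarrow>
     \<alpha> @ [x] \<in> L \<Longrightarrow> \<alpha> @ \<beta> @ \<gamma> @ [x] \<in> L \<Longrightarrow> \<alpha> @ \<beta> @ [x] \<in> L"

definition rk :: "'a list set \<Rightarrow> nat" where
  "rk L = Max (length ` L)"

definition Conts :: "'a set \<Rightarrow> 'a list set \<Rightarrow> nat \<Rightarrow> 'a list \<Rightarrow> 'a list set" where
  "Conts X L r \<alpha> = {\<beta> \<in> lists X. \<alpha> \<in> L \<and> length \<beta> = r \<and> \<alpha> @ \<beta> \<in> L}"

definition Cont :: "'a set \<Rightarrow> 'a list set \<Rightarrow> 'a list \<Rightarrow> 'a set" where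
  "Cont X L \<alpha> = {x. [x] \<in> Conts X L 1 \<alpha>}"

definition Cont_rel :: "'a set \<Rightarrow> 'a list set \<Rightarrow> 'a list \<Rightarrow> 'a rel" where
  "Cont_rel X L \<alpha> = {(x, y). x \<in> Cont X L \<alpha> \<and> y \<in> Cont X L \<alpha> \<and> \<alpha> @ [x, y] \<notin> L}"

definition Par :: "'a set \<Rightarrow> 'a list set \<Rightarrow> 'a list \<Rightarrow> 'a set set" where
  "Par X L \<alpha> = Cont X L \<alpha> // Cont_rel X L \<alpha>"

definition Des :: "'a set \<Rightarrow> 'a list set \<Rightarrow> 'a list \<Rightarrow> 'a \<Rightarrow> 'a set" where
  "Des X L \<alpha> x = {y \<in> X. \<alpha> @ [x, y] \<in> L \<and> \<alpha> @ [y] \<notin> L}"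

definition Pas :: "'a set \<Rightarrow> 'a list set \<Rightarrow> 'a list \<Rightarrow> 'a \<Rightarrow> 'a \<Rightarrow> 'a set" where
  "Pas X L \<alpha> x y = {z \<in> X. \<alpha> @ [z] \<notin> L \<and> \<alpha> @ [x, z] \<notin> L \<and> \<alpha> @ [y, z] \<notin> L \<and> \<alpha> @ [x, y, z] \<in> L}"

definition Act :: "'a set \<Rightarrow> 'a list set \<Rightarrow> 'a list \<Rightarrow> 'a \<Rightarrow> 'a \<Rightarrow> 'a set" where
  "Act X L \<alpha> x y = {z \<in> X. \<alpha> @ [z] \<notin> L \<and> \<alpha> @ [x, z] \<in> L \<and> \<alpha> @ [y, z] \<in> L \<and> \<alpha> @ [x, y, z] \<in> L}"

definition zero_ext :: "'a list set \<Rightarrow> ('a list \<Rightarrow> real) \<Rightarrow> 'a list \<Rightarrow> real" where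
  "zero_ext L q \<alpha> = (if \<alpha> \<in> L then q \<alpha> else 0)"

text \<open>
  In the conditions at a word \<open>\<alpha>\<close> below, \<open>q\<close> is the weight function already extended by zero
  outside \<open>L\<close>, and \<open>\<omega>\<close> is the extended weight function divided by the scale sequence.
\<close>

definition ContInv :: "'a set \<Rightarrow> 'a list set \<Rightarrow> ('a list \<Rightarrow> real) \<Rightarrow> 'a list \<Rightarrow> bool" where
  "ContInv X L q \<alpha> \<longleftrightarrow>
     (\<forall>x\<in>Cont X L \<alpha>. \<forall>y\<in>Cont X L \<alpha>. \<forall>\<beta>\<in>lists X. q (\<alpha> @ [x, y] @ \<beta>) = q (\<alpha> @ [y, x] @ \<beta>))"

definition PAMon :: "'a set \<Rightarrow> 'a list set \<Rightarrow> ('a list \<Rightarrow> real) \<Rightarrow> 'a list \<Rightarrow> bool" where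
  "PAMon X L q \<alpha> \<longleftrightarrow>
     (\<forall>x\<in>Cont X L \<alpha>. \<forall>y\<in>Cont X L \<alpha>. x \<noteq> y \<longrightarrow>
        (\<forall>r::nat.
          (\<Sum>z\<in>Pas X L \<alpha> x y. \<Sum>\<beta>\<in>Conts X L r (\<alpha> @ [x, y, z]). q (\<alpha> @ [x, y, z] @ \<beta>)) \<ge>
          (\<Sum>z\<in>Act X L \<alpha> x y. \<Sum>\<beta>\<in>Conts X L r (\<alpha> @ [x, y, z]). q (\<alpha> @ [x, y, z] @ \<beta>))))"

definition LogMod :: "'a set \<Rightarrow> 'a list set \<Rightarrow> ('a list \<Rightarrow> real) \<Rightarrow> 'a list \<Rightarrow> bool" where
  "LogMod X L \<omega> \<alpha> \<longleftrightarrow>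
     (\<forall>x\<in>Cont X L \<alpha>. \<forall>y\<in>Cont X L \<alpha>. \<alpha> @ [x, y] \<in> L \<longrightarrow>
        \<omega> (\<alpha> @ [x]) * \<omega> (\<alpha> @ [y]) = \<omega> \<alpha> * \<omega> (\<alpha> @ [x, y]))"

definition FewDes :: "'a set \<Rightarrow> 'a list set \<Rightarrow> 'a list \<Rightarrow> bool" where
  "FewDes X L \<alpha> \<longleftrightarrow> (\<forall>C\<in>Par X L \<alpha>. card C \<ge> 2 \<longrightarrow> (\<forall>x\<in>C. Des X L \<alpha> x = {}))"

definition SynMon :: "'a set \<Rightarrow> 'a list set \<Rightarrow> ('a list \<Rightarrow> real) \<Rightarrow> 'a list \<Rightarrow> bool" where
  "SynMon X L \<omega> \<alpha> \<longleftrightarrow>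
     (\<forall>x\<in>Cont X L \<alpha>. (\<omega> (\<alpha> @ [x]))\<^sup>2 \<ge> (\<Sum>y\<in>Des X L \<alpha> x. \<omega> \<alpha> * \<omega> (\<alpha> @ [x, y])))"

definition b_class :: "'a set \<Rightarrow> 'a list set \<Rightarrow> ('a list \<Rightarrow> real) \<Rightarrow> 'a list \<Rightarrow> 'a set \<Rightarrow> real" where
  "b_class X L \<omega> \<alpha> C =
     (if is_singleton C
      then let x = the_elem C
           in \<Sum>y\<in>Des X L \<alpha> x. \<omega> \<alpha> * \<omega> (\<alpha> @ [x, y]) / (\<omega> (\<alpha> @ [x]))\<^sup>2
      else 0)"

text \<open>
  The premise of \<open>ScaleMon\<close> encodes the convention that the condition holds trivially when
  \<open>c\<^sub>\<ell>\<^sub>+\<^sub>1\<^sup>2 \<ge> c\<^sub>\<ell> c\<^sub>\<ell>\<^sub>+\<^sub>2\<close>; otherwise \<open>b_class < 1\<close> is required, so no division by zero occurs.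
\<close>

definition ScaleMon ::
    "'a set \<Rightarrow> 'a list set \<Rightarrow> (nat \<Rightarrow> real) \<Rightarrow> ('a list \<Rightarrow> real) \<Rightarrow> 'a list \<Rightarrow> bool" where
  "ScaleMon X L c \<omega> \<alpha> \<longleftrightarrow>
     (let l = length \<alpha> in
      (c (l + 1))\<^sup>2 < c l * c (l + 2) \<longrightarrow>
        (\<forall>C\<in>Par X L \<alpha>. b_class X L \<omega> \<alpha> C < 1) \<and>
        (1 - (c (l + 1))\<^sup>2 / (c l * c (l + 2))) *
          (\<Sum>C\<in>Par X L \<alpha>. 1 / (1 - b_class X L \<omega> \<alpha> C)) \<le> 1)"

text \<open>
  The scale sequence is a function on \<open>nat\<close>, of which only the values at \<open>0, \<dots>, rk L\<close> matter.
\<close>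

definition admissible :: "'a set \<Rightarrow> 'a list set \<Rightarrow> nat \<Rightarrow> ('a list \<Rightarrow> real) \<Rightarrow> bool" where
  "admissible X L k q \<longleftrightarrow>
     (\<exists>c :: nat \<Rightarrow> real.
        (\<forall>i\<le>rk L. c i > 0) \<and>
        (let q' = zero_ext L q; \<omega> = (\<lambda>\<alpha>. q' \<alpha> / c (length \<alpha>)) in
         \<forall>\<alpha>\<in>L. length \<alpha> < k \<longrightarrow>
           ContInv X L q' \<alpha> \<and>
           PAMon X L q' \<alpha> \<and>
           LogMod X L \<omega> \<alpha> \<and>
           FewDes X L \<alpha> \<and>
           SynMon X L \<omega> \<alpha> \<and>
           ScaleMon X L c \<omega> \<alpha>))"

definition Lsum :: "'a list set \<Rightarrow> ('a list \<Rightarrow> real) \<Rightarrow> nat \<Rightarrow> real" where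
  "Lsum L q j = (\<Sum>\<alpha> | \<alpha> \<in> L \<and> length \<alpha> = j. q \<alpha>)"

definition Lsum_at :: "'a set \<Rightarrow> 'a list set \<Rightarrow> ('a list \<Rightarrow> real) \<Rightarrow> 'a list \<Rightarrow> nat \<Rightarrow> real" where
  "Lsum_at X L q \<alpha> j = (\<Sum>\<beta>\<in>Conts X L j \<alpha>. q (\<alpha> @ \<beta>))"

end

theory Submission
  imports Defs "HOL-Analysis.Analysis"
begin

text \<open>
  Following Chan and Pak's combinatorial atlases, every word \<open>\<alpha>\<close> and every \<open>n\<close> carry a symmetric
  matrix \<open>A\<close>, indexed by the continuations of \<open>\<alpha>\<close> and one extra null vertex, such that for the
  indicator \<open>f\<close> of the continuations and the indicator \<open>g\<close> of the null vertex the values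
  \<open>\<langle>g,Ag\<rangle>\<close>, \<open>\<langle>f,Ag\<rangle>\<close>, \<open>\<langle>f,Af\<rangle>\<close> are \<open>L\<^bsub>q,\<alpha>\<^esub>(n)\<close>, \<open>L\<^bsub>q,\<alpha>\<^esub>(n+1)\<close>, \<open>L\<^bsub>q,\<alpha>\<^esub>(n+2)\<close>. These matrices are
  hyperbolic (they satisfy the reversed Cauchy-Schwarz inequality), by induction on \<open>n\<close>. For \<open>n = 0\<close>
  this is a completion of the square, where \<open>LogMod\<close>, \<open>FewDes\<close>, \<open>SynMon\<close> and \<open>ScaleMon\<close> enter. In the
  induction step the rows of the matrix at \<open>(\<alpha>, n + 1)\<close> are computed by the matrices at \<open>(\<alpha>x, n)\<close>,
  and by \<open>PAMon\<close> the sum of the quadratic forms at \<open>(\<alpha>x, n)\<close>, pulled back to \<open>\<alpha>\<close>, dominates the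
  form at \<open>(\<alpha>, n + 1)\<close>; a Perron-Frobenius argument then shows that there is only one positive
  eigenvalue.

  If equality holds at the empty word, then \<open>f - s g\<close> lies in the kernel of \<open>A\<close> for some \<open>s\<close>. The
  pullback inequality passes this on to the matrices at \<open>(\<alpha>x, n - 1)\<close>, with the same \<open>s\<close>, down to
  the words of length \<open>k - 1\<close>, where it is the claimed identity.
\<close>

section \<open>Hyperbolic quadratic forms\<close>

definition bil :: "'i set \<Rightarrow> ('i \<Rightarrow> 'i \<Rightarrow> real) \<Rightarrow> ('i \<Rightarrow> real) \<Rightarrow> ('i \<Rightarrow> real) \<Rightarrow> real" where
  "bil J M v w = (\<Sum>i\<in>J. v i * (\<Sum>j\<in>J. M i j * w j))"

definition symmetric_on :: "'i set \<Rightarrow> ('i \<Rightarrow> 'i \<Rightarrow> real) \<Rightarrow> bool" where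
  "symmetric_on J M \<longleftrightarrow> (\<forall>i\<in>J. \<forall>j\<in>J. M i j = M j i)"

definition hyperbolic :: "'i set \<Rightarrow> ('i \<Rightarrow> 'i \<Rightarrow> real) \<Rightarrow> bool" where
  "hyperbolic J M \<longleftrightarrow> (\<forall>v w. bil J M w w > 0 \<longrightarrow> bil J M v v * bil J M w w \<le> (bil J M v w)\<^sup>2)"

lemma bil_commute:
  assumes "symmetric_on J M"
  shows "bil J M v w = bil J M w v"
proof -
  have "bil J M v w = (\<Sum>i\<in>J. \<Sum>j\<in>J. v i * (M i j * w j))"
    by (simp add: bil_def sum_distrib_left)
  also have "\<dots> = (\<Sum>j\<in>J. \<Sum>i\<in>J. v i * (M i j * w j))"
    by (rule sum.swap)
  also have "\<dots> = (\<Sum>j\<in>J. \<Sum>i\<in>J. w j * (M j i * v i))"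
    using assms by (intro sum.cong refl) (simp add: symmetric_on_def)
  finally show ?thesis
    by (simp add: bil_def sum_distrib_left)
qed

lemma bil_linear_left: "bil J M (\<lambda>i. u i + c * v i) w = bil J M u w + c * bil J M v w"
  by (simp add: bil_def distrib_right sum.distrib sum_distrib_left mult.assoc)

lemma bil_linear_right: "bil J M w (\<lambda>i. u i + c * v i) = bil J M w u + c * bil J M w v"
  by (simp add: bil_def distrib_left sum.distrib sum_distrib_left mult.left_commute)

lemma bil_linear_matrix:
  "bil J (\<lambda>i j. s * M i j + t * N i j) v w = s * bil J M v w + t * bil J N v w"
  by (simp add: bil_def distrib_left distrib_right sum.distrib sum_distrib_left ac_simps)

lemma bil_add_scaled:
  assumes "symmetric_on J M"
  shows "bil J M (\<lambda>i. u i + c * v i) (\<lambda>i. u i + c * v i)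
    = bil J M u u + 2 * c * bil J M u v + c\<^sup>2 * bil J M v v"
  by (simp add: bil_linear_left bil_linear_right bil_commute[OF assms, of v u]
      algebra_simps power2_eq_square)

text \<open>Any \<open>w\<close> of positive norm pairs nontrivially with \<open>g\<close>, so
  \<open>v\<close> can be moved along \<open>w\<close> until it is orthogonal to \<open>g\<close>.
  Nonpositivity there, after completing the square, is the reversed Cauchy-Schwarz
  inequality.\<close>

lemma hyperbolicI:
  assumes sym: "symmetric_on J M"
    and neg: "\<And>v. bil J M v g = 0 \<Longrightarrow> bil J M v v \<le> 0"
  shows "hyperbolic J M"
  unfolding hyperbolic_def
proof (intro allI impI)
  fix v w assume w: "bil J M w w > 0"
  then have wg: "bil J M w g \<noteq> 0"
    using neg by force
  define c where "c = - (bil J M v g / bil J M w g)"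
  have "bil J M (\<lambda>i. v i + c * w i) g = 0"
    unfolding bil_linear_left c_def using wg by simp
  then have "bil J M v v + 2 * c * bil J M v w + c\<^sup>2 * bil J M w w \<le> 0"
    using neg bil_add_scaled[OF sym] by metis
  then have "bil J M w w * (bil J M v v + 2 * c * bil J M v w + c\<^sup>2 * bil J M w w) \<le> 0"
    using w by (simp add: mult_le_0_iff)
  moreover have "bil J M w w * (bil J M v v + 2 * c * bil J M v w + c\<^sup>2 * bil J M w w)
      = bil J M v v * bil J M w w + (bil J M v w + c * bil J M w w)\<^sup>2 - (bil J M v w)\<^sup>2"
    by (simp add: algebra_simps power2_eq_square)
  ultimately show "bil J M v v * bil J M w w \<le> (bil J M v w)\<^sup>2"
    by (smt (verit) zero_le_power2)
qed

lemma hyperbolic_nonpos: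
  assumes "hyperbolic J M" "bil J M w w > 0" "bil J M v w = 0"
  shows "bil J M v v \<le> 0"
proof -
  have "bil J M v v * bil J M w w \<le> 0"
    using assms unfolding hyperbolic_def by (metis zero_power2)
  then show ?thesis
    using assms(2) by (simp add: mult_le_0_iff)
qed

lemma quadratic_nonpos_imp_linear_zero:
  fixes a b :: real
  assumes "\<And>t. 2 * t * a + t\<^sup>2 * b \<le> 0"
  shows "a = 0"
proof (rule ccontr)
  assume a: "a \<noteq> 0"
  \<comment> \<open>Same sign as \<open>a\<close>, and small enough that the linear term outweighs
    the quadratic one.\<close>
  define t where "t = a / (\<bar>b\<bar> + 1)"
  have "2 * t * a + t\<^sup>2 * b = a\<^sup>2 * (2 * (\<bar>b\<bar> + 1) + b) / (\<bar>b\<bar> + 1)\<^sup>2"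
    unfolding t_def by (simp add: divide_simps power2_eq_square) (simp add: algebra_simps)
  also have "\<dots> > 0"
    using a by (intro divide_pos_pos mult_pos_pos) auto
  finally show False
    using assms[of t] by simp
qed

text \<open>Orthogonally to \<open>w\<close> the form is nonpositive, so an isotropic
  \<open>v\<close> there is a maximiser and its first variation vanishes; the direction
  \<open>w\<close> itself pairs to zero with \<open>v\<close>.\<close>

lemma hyperbolic_kernel:
  assumes sym: "symmetric_on J M" and hyp: "hyperbolic J M"
    and w: "bil J M w w > 0" and vw: "bil J M v w = 0" and vv: "bil J M v v = 0"
  shows "bil J M u v = 0"
proof -
  define c where "c = - (bil J M u w / bil J M w w)"
  define u' where "u' = (\<lambda>i. u i + c * w i)"
  have u'w: "bil J M u' w = 0"
    unfolding u'_def bil_linear_left c_def using w by simp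
  have "2 * t * bil J M v u' + t\<^sup>2 * bil J M u' u' \<le> 0" for t
  proof -
    have "bil J M (\<lambda>i. v i + t * u' i) w = 0"
      by (simp add: bil_linear_left vw u'w)
    then have "bil J M (\<lambda>i. v i + t * u' i) (\<lambda>i. v i + t * u' i) \<le> 0"
      using hyperbolic_nonpos[OF hyp w] by blast
    then show ?thesis
      by (simp add: bil_add_scaled[OF sym] vv)
  qed
  then have "bil J M v u' = 0"
    by (rule quadratic_nonpos_imp_linear_zero)
  then have "bil J M v u + c * bil J M v w = 0"
    by (simp add: u'_def bil_linear_right)
  then show ?thesis
    using vw bil_commute[OF sym, of u v] by simp
qed

text \<open>Hyperbolicity is a closed condition: positivity at \<open>w\<close> persists for
  \<open>t\<close> near \<open>1\<close>, and the inequality passes to the limit.\<close>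

lemma hyperbolic_limit:
  assumes hyp: "\<And>t. 0 < t \<Longrightarrow> t < 1 \<Longrightarrow> hyperbolic J (\<lambda>i j. t * M i j + (1 - t) * N i j)"
  shows "hyperbolic J M"
  unfolding hyperbolic_def
proof (intro allI impI)
  fix v w assume w: "bil J M w w > 0"
  define B where "B = (\<lambda>u w t. t * bil J M u w + (1 - t) * bil J N u w)"
  have lim: "((\<lambda>t. B u w t) \<longlongrightarrow> bil J M u w) (at_left 1)" for u w
    unfolding B_def by (auto intro!: tendsto_eq_intros)
  have "\<forall>\<^sub>F t in at_left (1::real). t \<in> {0<..<1}"
    by (rule eventually_at_leftI[of 0]) auto
  moreover have "\<forall>\<^sub>F t in at_left 1. B w w t > 0"
    using lim w by (rule order_tendstoD)
  ultimately have "\<forall>\<^sub>F t in at_left 1. B v v t * B w w t \<le> (B v w t)\<^sup>2"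
  proof eventually_elim
    case (elim t)
    then show ?case
      using hyp[of t] by (simp add: hyperbolic_def bil_linear_matrix B_def)
  qed
  then show "bil J M v v * bil J M w w \<le> (bil J M v w)\<^sup>2"
    by (intro tendsto_le[OF _ tendsto_power[OF lim] tendsto_mult[OF lim lim]]) auto
qed

section \<open>A Perron-Frobenius criterion for hyperbolicity\<close>

text \<open>
  With respect to the inner product with weights \<open>d i = (\<Sum>j. M i j * h j) / h i\<close>, the operator \<open>N\<close>
  given by \<open>M\<close> fixes \<open>h\<close>, is bounded by \<open>1\<close> with eigenspace spanned by \<open>h\<close>, and satisfies
  \<open>N \<le> N\<^sup>2\<close> by the last assumption. A positive maximum of its Rayleigh quotient on the complement of
  \<open>h\<close> would be an eigenvalue that is at least \<open>1\<close>.
\<close>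

lemma perron_hyperbolic:
  fixes M :: "'i \<Rightarrow> 'i \<Rightarrow> real"
  assumes J: "finite J" and sym: "symmetric_on J M"
    and nonneg: "\<And>i j. i \<in> J \<Longrightarrow> j \<in> J \<Longrightarrow> M i j \<ge> 0"
    and e: "e \<in> J" "\<And>j. j \<in> J \<Longrightarrow> M e j > 0"
    and h: "\<And>i. i \<in> J \<Longrightarrow> h i > 0"
    and sq: "\<And>v. bil J M v v \<le> (\<Sum>i\<in>J. h i * (\<Sum>j\<in>J. M i j * v j)\<^sup>2 / (\<Sum>j\<in>J. M i j * h j))"
  shows "hyperbolic J M"
proof (rule hyperbolicI[OF sym, where g = h])
  fix v0 assume v0h: "bil J M v0 h = 0"
  define d where "d i = (\<Sum>j\<in>J. M i j * h j) / h i" for i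
  define nrm where "nrm v = (\<Sum>i\<in>J. d i * (v i)\<^sup>2)" for v
  have Mh: "(\<Sum>j\<in>J. M i j * h j) = d i * h i" if "i \<in> J" for i
    using h[OF that] by (simp add: d_def)
  have "(\<Sum>j\<in>J. M i j * h j) > 0" if "i \<in> J" for i
  proof -
    have "M i e * h e > 0"
      using e(2)[OF that] h[OF e(1)] sym that e(1) by (auto simp: symmetric_on_def)
    also have "M i e * h e \<le> (\<Sum>j\<in>J. M i j * h j)"
      using J e nonneg h that by (intro member_le_sum mult_nonneg_nonneg) (auto simp: less_imp_le)
    finally show ?thesis .
  qed
  then have d: "d i > 0" if "i \<in> J" for i
    using h that by (simp add: d_def)
  have bil_h: "bil J M v h = (\<Sum>i\<in>J. d i * h i * v i)" for v
    unfolding bil_def by (intro sum.cong refl) (simp add: Mh)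
  \<comment> \<open>The Dirichlet form of the weights \<open>M i j * h i * h j\<close>; being
    nonnegative, it bounds the Rayleigh quotient by \<open>1\<close>.\<close>
  have gap: "(\<Sum>i\<in>J. \<Sum>j\<in>J. M i j * h i * h j * (v i / h i - v j / h j)\<^sup>2) = 2 * nrm v - 2 * bil J M v v"
    (is "?G = _") for v
  proof -
    have "?G = (\<Sum>i\<in>J. \<Sum>j\<in>J. (v i)\<^sup>2 / h i * (M i j * h j) + (v j)\<^sup>2 / h j * (M j i * h i)
        - 2 * (v i * (M i j * v j)))"
    proof (intro sum.cong refl)
      fix i j assume ij: "i \<in> J" "j \<in> J"
      then have "M j i = M i j" "h i \<noteq> 0" "h j \<noteq> 0"
        using sym h by (auto simp: symmetric_on_def less_imp_neq[symmetric] dest: less_imp_neq)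
      then show "M i j * h i * h j * (v i / h i - v j / h j)\<^sup>2 =
          (v i)\<^sup>2 / h i * (M i j * h j) + (v j)\<^sup>2 / h j * (M j i * h i) - 2 * (v i * (M i j * v j))"
        by (simp add: field_simps power2_eq_square)
    qed
    also have "\<dots> = (\<Sum>i\<in>J. \<Sum>j\<in>J. (v i)\<^sup>2 / h i * (M i j * h j))
        + (\<Sum>i\<in>J. \<Sum>j\<in>J. (v j)\<^sup>2 / h j * (M j i * h i)) - 2 * bil J M v v"
      by (simp add: sum.distrib sum_subtractf bil_def sum_distrib_left)
    also have "(\<Sum>i\<in>J. \<Sum>j\<in>J. (v j)\<^sup>2 / h j * (M j i * h i)) =
        (\<Sum>i\<in>J. \<Sum>j\<in>J. (v i)\<^sup>2 / h i * (M i j * h j))"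
      by (rule sum.swap)
    also have "(\<Sum>i\<in>J. \<Sum>j\<in>J. (v i)\<^sup>2 / h i * (M i j * h j)) = nrm v"
      unfolding nrm_def
      by (intro sum.cong refl)
        (simp add: d_def sum_distrib_left sum_distrib_right sum_divide_distrib ac_simps)
    finally show ?thesis by simp
  qed
  have G_nonneg: "M i j * h i * h j * (v i / h i - v j / h j)\<^sup>2 \<ge> 0" if "i \<in> J" "j \<in> J" for v i j
    using nonneg h that by (simp add: less_imp_le)
  show "bil J M v0 v0 \<le> 0"
  proof (rule ccontr)
    assume "\<not> bil J M v0 v0 \<le> 0"
    then have pos: "bil J M v0 v0 > 0" by simp
    \<comment> \<open>The unit sphere orthogonal to \<open>h\<close>. Coordinates outside
      \<open>J\<close> are set to \<open>0\<close>, and the box, implied on \<open>J\<close> by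
      \<open>nrm v = 1\<close>, yields compactness in the product topology.\<close>
    define K where "K = {v. v \<in> Pi\<^sub>E UNIV (\<lambda>i. if i \<in> J then {- sqrt (1 / d i)..sqrt (1 / d i)} else {0})
      \<and> nrm v = 1 \<and> (\<Sum>i\<in>J. d i * h i * v i) = 0}"
    have cont: "continuous_on UNIV (\<lambda>v. v i)" for i :: 'i
      by (rule continuous_on_product_coordinates)
    have K: "compact K"
    proof -
      have "compact (Pi\<^sub>E UNIV (\<lambda>i. if i \<in> J then {- sqrt (1 / d i)..sqrt (1 / d i)} else {0}))"
        using compactin_PiE[of "\<lambda>_ :: 'i. euclidean :: real topology" UNIV
          "\<lambda>i. if i \<in> J then {- sqrt (1 / d i)..sqrt (1 / d i)} else {0}"]
        unfolding euclidean_product_topology compactin_euclidean_iff by simp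
      moreover have "closed {v. nrm v = 1}"
        unfolding nrm_def by (intro closed_Collect_eq continuous_intros cont)
      moreover have "closed {v. (\<Sum>i\<in>J. d i * h i * v i) = 0}"
        by (intro closed_Collect_eq continuous_intros cont)
      ultimately have "compact ((Pi\<^sub>E UNIV (\<lambda>i. if i \<in> J then {- sqrt (1 / d i)..sqrt (1 / d i)} else {0}))
          \<inter> {v. nrm v = 1} \<inter> {v. (\<Sum>i\<in>J. d i * h i * v i) = 0})"
        by (intro compact_Int_closed)
      then show ?thesis
        by (simp add: K_def Int_def conj_assoc)
    qed
    have scale: "\<exists>u\<in>K. bil J M w w = bil J M u u * nrm w"
      if "bil J M w w > 0" "bil J M w h = 0" for w
    proof -
      have "nrm w \<ge> 0" "nrm w \<noteq> 0"
      proof -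
        show "nrm w \<ge> 0"
          unfolding nrm_def by (intro sum_nonneg mult_nonneg_nonneg) (auto simp: less_imp_le d)
        show "nrm w \<noteq> 0"
          using gap[of w] that sum_nonneg[of J "\<lambda>i. \<Sum>j\<in>J. M i j * h i * h j * (w i / h i - w j / h j)\<^sup>2"]
            sum_nonneg[of J] G_nonneg by (smt (verit, best))
      qed
      then have nw: "nrm w > 0" by simp
      define u where "u i = (if i \<in> J then w i / sqrt (nrm w) else 0)" for i
      have nu: "nrm u = 1"
        using nw unfolding nrm_def[of u] u_def
        by (simp add: power_divide sum_divide_distrib[symmetric]) (simp add: nrm_def)
      have "(\<Sum>i\<in>J. d i * h i * u i) = (\<Sum>i\<in>J. d i * h i * w i) / sqrt (nrm w)"
        by (simp add: u_def sum_divide_distrib)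
      then have uh: "(\<Sum>i\<in>J. d i * h i * u i) = 0"
        using that by (simp add: bil_h)
      have "\<bar>u i\<bar> \<le> sqrt (1 / d i)" if "i \<in> J" for i
      proof -
        have "d i * (u i)\<^sup>2 \<le> 1"
          unfolding nu[symmetric] nrm_def using that J d
          by (intro member_le_sum) (auto simp: less_imp_le)
        then have "(u i)\<^sup>2 \<le> 1 / d i"
          using d[OF that] by (simp add: field_simps)
        then show ?thesis
          using real_le_rsqrt by fastforce
      qed
      then have "u i \<in> (if i \<in> J then {- sqrt (1 / d i)..sqrt (1 / d i)} else {0})" for i
        by (cases "i \<in> J") (auto simp only: if_True if_False atLeastAtMost_iff abs_le_iff
            u_def minus_le_iff singleton_iff)
      then have "u \<in> K"
        using nu uh unfolding K_def by (simp only: PiE_UNIV_domain) blast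
      moreover have "bil J M u u = bil J M w w / nrm w"
      proof -
        have "bil J M u u = (\<Sum>i\<in>J. \<Sum>j\<in>J. w i * (M i j * w j) / nrm w)"
          unfolding bil_def sum_distrib_left using nw
          by (intro sum.cong refl) (simp add: u_def)
        then show ?thesis
          by (simp add: bil_def sum_distrib_left sum_divide_distrib)
      qed
      ultimately show ?thesis
        using nw by (intro bexI[of _ u]) auto
    qed
    have "continuous_on K (\<lambda>v. bil J M v v)"
      unfolding bil_def
      by (rule continuous_on_subset[of UNIV]) (auto intro!: continuous_intros cont)
    then obtain v where v: "v \<in> K" "\<And>u. u \<in> K \<Longrightarrow> bil J M u u \<le> bil J M v v"
      using continuous_attains_sup[OF K] scale[OF pos v0h] by blast
    define \<rho> where "\<rho> = bil J M v v"
    have nv: "nrm v = 1" and vh: "bil J M v h = 0"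
      using v(1) by (auto simp: K_def bil_h)
    have nrm_nonneg: "nrm w \<ge> 0" for w
      unfolding nrm_def by (intro sum_nonneg mult_nonneg_nonneg) (auto simp: less_imp_le d)
    have \<rho>: "\<rho> > 0"
    proof -
      obtain u where "u \<in> K" "bil J M v0 v0 = bil J M u u * nrm v0"
        using scale[OF pos v0h] by blast
      then show ?thesis
        using v(2)[of u] pos nrm_nonneg[of v0]
        by (smt (verit, ccfv_SIG) \<rho>_def mult_nonpos_nonneg)
    qed
    have max: "bil J M u u \<le> \<rho> * nrm u" if "bil J M u h = 0" for u
    proof (cases "bil J M u u > 0")
      case True
      then show ?thesis
        using scale[OF True that] v(2) nrm_nonneg[of u] by (auto simp: \<rho>_def mult_right_mono)
    next
      case False
      then show ?thesis
        using \<rho> nrm_nonneg[of u] by (smt (verit) mult_nonneg_nonneg)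
    qed
    \<comment> \<open>First-order condition at the maximiser \<open>v\<close> for variations
      orthogonal to \<open>h\<close>.\<close>
    have perp: "bil J M v u = \<rho> * (\<Sum>i\<in>J. d i * v i * u i)" if uh: "bil J M u h = 0" for u
    proof -
      have "2 * t * (bil J M v u - \<rho> * (\<Sum>i\<in>J. d i * v i * u i)) + t\<^sup>2 * (bil J M u u - \<rho> * nrm u) \<le> 0" for t
      proof -
        have "bil J M (\<lambda>i. v i + t * u i) h = 0"
          by (simp add: bil_linear_left vh uh)
        then have "\<rho> + 2 * t * bil J M v u + t\<^sup>2 * bil J M u u \<le> \<rho> * nrm (\<lambda>i. v i + t * u i)"
          using max[of "\<lambda>i. v i + t * u i"] by (simp add: bil_add_scaled[OF sym] \<rho>_def)
        also have "nrm (\<lambda>i. v i + t * u i) = nrm v + 2 * t * (\<Sum>i\<in>J. d i * v i * u i) + t\<^sup>2 * nrm u"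
          by (simp add: nrm_def sum_distrib_left sum.distrib[symmetric] algebra_simps power2_eq_square)
        finally show ?thesis
          by (simp add: nv algebra_simps)
      qed
      then show ?thesis
        using quadratic_nonpos_imp_linear_zero by fastforce
    qed
    \<comment> \<open>Every \<open>u\<close> splits into such a variation and a multiple of
      \<open>h\<close>, and both sides vanish on \<open>h\<close>.\<close>
    have all: "bil J M v u = \<rho> * (\<Sum>i\<in>J. d i * v i * u i)" for u
    proof -
      have hh: "bil J M h h > 0"
        unfolding bil_h using e h d by (intro sum_pos2[OF J e(1)]) (auto simp: less_imp_le)
      define c where "c = - (bil J M u h / bil J M h h)"
      have "bil J M (\<lambda>i. u i + c * h i) h = 0"
        unfolding bil_linear_left c_def using hh by simp
      then have "bil J M v u + c * bil J M v h =
          \<rho> * (\<Sum>i\<in>J. d i * v i * (u i + c * h i))"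
        using perp[of "\<lambda>i. u i + c * h i"] unfolding bil_linear_right by simp
      also have "(\<Sum>i\<in>J. d i * v i * (u i + c * h i)) = (\<Sum>i\<in>J. d i * v i * u i) + c * bil J M v h"
        by (simp add: bil_h distrib_left sum.distrib sum_distrib_left ac_simps)
      finally show ?thesis by (simp add: vh)
    qed
    have eig: "(\<Sum>j\<in>J. M i j * v j) = \<rho> * d i * v i" if i: "i \<in> J" for i
    proof -
      have "bil J M v (\<lambda>j. of_bool (j = i)) = bil J M (\<lambda>j. of_bool (j = i)) v"
        by (rule bil_commute[OF sym])
      also have "\<dots> = (\<Sum>j\<in>J. M i j * v j)"
        using J i by (simp add: bil_def of_bool_def if_distrib[of "\<lambda>x. x * _"] cong: if_cong)
      finally show ?thesis
        using J i by (simp add: all of_bool_def if_distrib[of "\<lambda>x. _ * x"] cong: if_cong)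
    qed
    \<comment> \<open>Inserting the eigenvector equation into \<open>sq\<close> gives
      \<open>\<rho> \<le> \<rho>\<^sup>2\<close>, hence \<open>\<rho> \<ge> 1\<close>, and by
      \<open>gap\<close> the Dirichlet form vanishes at \<open>v\<close>.\<close>
    have "\<rho> \<le> (\<Sum>i\<in>J. h i * (\<rho> * d i * v i)\<^sup>2 / (d i * h i))"
      using sq[of v] by (simp add: \<rho>_def eig Mh cong: sum.cong)
    also have "\<dots> = \<rho>\<^sup>2 * nrm v"
      unfolding nrm_def sum_distrib_left
    proof (intro sum.cong refl)
      fix i assume "i \<in> J"
      then show "h i * (\<rho> * d i * v i)\<^sup>2 / (d i * h i) = \<rho>\<^sup>2 * (d i * (v i)\<^sup>2)"
        using h[of i] d[of i] by (simp add: field_simps power2_eq_square)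
    qed
    finally have "\<rho> \<ge> 1"
      using \<rho> nv by (simp add: power2_eq_square)
    then have "(\<Sum>i\<in>J. \<Sum>j\<in>J. M i j * h i * h j * (v i / h i - v j / h j)\<^sup>2) \<le> 0"
      by (simp add: gap nv \<rho>_def)
    \<comment> \<open>Row \<open>e\<close> has only positive entries, so its part of the Dirichlet
      form alone makes \<open>v\<close> a multiple of \<open>h\<close>, against
      orthogonality.\<close>
    moreover have "(\<Sum>j\<in>J. M e j * h e * h j * (v e / h e - v j / h j)\<^sup>2)
        \<le> (\<Sum>i\<in>J. \<Sum>j\<in>J. M i j * h i * h j * (v i / h i - v j / h j)\<^sup>2)"
      using e J by (intro member_le_sum) (auto intro!: sum_nonneg G_nonneg)
    ultimately have "(\<Sum>j\<in>J. M e j * h e * h j * (v e / h e - v j / h j)\<^sup>2) \<le> 0"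
      by linarith
    then have "(\<Sum>j\<in>J. M e j * h e * h j * (v e / h e - v j / h j)\<^sup>2) = 0"
      using e by (intro antisym sum_nonneg G_nonneg) auto
    then have "\<forall>j\<in>J. M e j * h e * h j * (v e / h e - v j / h j)\<^sup>2 = 0"
      using J e G_nonneg by (subst (asm) sum_nonneg_eq_0_iff) auto
    then have proportional: "v j = v e / h e * h j" if "j \<in> J" for j
      using that e h by (force simp: field_simps)
    have "nrm v = (\<Sum>i\<in>J. d i * h i * v i * (v e / h e))"
      unfolding nrm_def using proportional
      by (intro sum.cong refl) (metis (no_types, lifting) mult.assoc mult.commute power2_eq_square)
    also have "\<dots> = v e / h e * bil J M v h"
      by (simp add: bil_h sum_distrib_left sum_distrib_right ac_simps)
    finally show False
      using nv vh by simp
  qed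
qed


section \<open>Continuations and descents in greedoids\<close>

context greedoid
begin

lemma Cont_iff: "x \<in> Cont X L \<alpha> \<longleftrightarrow> \<alpha> @ [x] \<in> L"
  using words_over hereditary by (auto simp: Cont_def Conts_def)

lemma finite_Cont: "finite (Cont X L \<alpha>)"
  by (rule finite_subset[OF _ finite_ground]) (use words_over in \<open>auto simp: Cont_iff\<close>)

lemma Cont_notin: "\<alpha> \<notin> L \<Longrightarrow> Cont X L \<alpha> = {}"
  by (auto simp: Cont_def Conts_def)

lemma Des_eq: "Des X L \<alpha> x = Cont X L (\<alpha> @ [x]) - Cont X L \<alpha>"
  using words_over by (auto simp: Des_def Cont_iff)

lemma no_repeat: "\<alpha> @ [x, x] \<notin> L"
  using simple by fastforce

text \<open>Exchange against the longer word adds one of its letters to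
  \<open>\<alpha> @ [y]\<close>, and simplicity leaves only \<open>x\<close>.\<close>

lemma swap_word:
  assumes "\<alpha> @ [y] \<in> L" "\<alpha> @ [x, y] \<in> L"
  shows "\<alpha> @ [y, x] \<in> L"
proof -
  obtain z where z: "z \<in> set (\<alpha> @ [x, y])" "(\<alpha> @ [y]) @ [z] \<in> L"
    using exchange[OF assms(2,1)] by auto
  then have "z = x"
    using simple[OF z(2)] by auto
  then show ?thesis
    using z(2) by simp
qed

lemma exists_max_word: "\<exists>\<mu>\<in>L. length \<mu> = rk L"
proof -
  have "rk L \<in> length ` L"
    unfolding rk_def using finite_words nil_word by (intro Max_in) auto
  then show ?thesis by auto
qed

lemma Cont_nonempty:
  assumes "\<alpha> \<in> L" "length \<alpha> < rk L"
  shows "Cont X L \<alpha> \<noteq> {}"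
proof -
  obtain \<mu> where "\<mu> \<in> L" "length \<mu> = rk L"
    using exists_max_word by blast
  then show ?thesis
    using exchange[of \<mu> \<alpha>] assms by (auto simp: Cont_iff)
qed

lemma equiv_Cont_rel: "equiv (Cont X L \<alpha>) (Cont_rel X L \<alpha>)"
proof (rule equivI)
  show "Cont_rel X L \<alpha> \<subseteq> Cont X L \<alpha> \<times> Cont X L \<alpha>"
    by (auto simp: Cont_rel_def)
  show "refl_on (Cont X L \<alpha>) (Cont_rel X L \<alpha>)"
    by (auto simp: refl_on_def Cont_rel_def no_repeat)
  show "sym (Cont_rel X L \<alpha>)"
    using swap_word by (auto simp: sym_def Cont_rel_def Cont_iff)
  show "trans (Cont_rel X L \<alpha>)"
  proof (rule transI)
    fix x y z assume xy: "(x, y) \<in> Cont_rel X L \<alpha>" and yz: "(y, z) \<in> Cont_rel X L \<alpha>"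
    have "\<alpha> @ [x, z] \<notin> L"
    proof
      assume xz: "\<alpha> @ [x, z] \<in> L"
      have y: "\<alpha> @ [y] \<in> L"
        using xy by (simp add: Cont_rel_def Cont_iff)
      \<comment> \<open>By simplicity the new letter is \<open>x\<close> or \<open>z\<close>, but
        both are related to \<open>y\<close>.\<close>
      obtain u where u: "u \<in> set (\<alpha> @ [x, z])" "(\<alpha> @ [y]) @ [u] \<in> L"
        using exchange[OF xz y] by auto
      then have "u = x \<or> u = z"
        using simple[OF u(2)] by auto
      then show False
        using u(2) xy yz swap_word[of \<alpha> x y] by (auto simp: Cont_rel_def Cont_iff)
    qed
    then show "(x, z) \<in> Cont_rel X L \<alpha>"
      using xy yz by (simp add: Cont_rel_def)
  qed
qed

lemma sum_Par: "(\<Sum>C\<in>Par X L \<alpha>. \<Sum>x\<in>C. f x) = (\<Sum>x\<in>Cont X L \<alpha>. f x)"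
proof -
  have sub: "C \<subseteq> Cont X L \<alpha>" if "C \<in> Par X L \<alpha>" for C
    using Union_quotient[OF equiv_Cont_rel] that unfolding Par_def by blast
  have "(\<Sum>x\<in>\<Union> (Par X L \<alpha>). f x) = (\<Sum>C\<in>Par X L \<alpha>. \<Sum>x\<in>C. f x)"
  proof (subst sum.Union_disjoint)
    show "\<forall>C\<in>Par X L \<alpha>. finite C"
      using sub finite_Cont by (meson finite_subset)
    show "\<forall>C\<in>Par X L \<alpha>. \<forall>D\<in>Par X L \<alpha>. C \<noteq> D \<longrightarrow> C \<inter> D = {}"
      using quotient_disj[OF equiv_Cont_rel] unfolding Par_def by blast
  qed simp
  then show ?thesis
    using Union_quotient[OF equiv_Cont_rel] by (simp add: Par_def)
qed

lemma Par_eq: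
  assumes "C \<in> Par X L \<alpha>" "x \<in> C"
  shows "C = {y \<in> Cont X L \<alpha>. \<alpha> @ [x, y] \<notin> L}"
proof -
  obtain z where z: "C = Cont_rel X L \<alpha> `` {z}" "z \<in> Cont X L \<alpha>"
    using assms(1) unfolding Par_def by (rule quotientE)
  have "(z, x) \<in> Cont_rel X L \<alpha>"
    using assms(2) z by simp
  then have "C = Cont_rel X L \<alpha> `` {x}"
    using z equiv_class_eq[OF equiv_Cont_rel] by blast
  moreover have "x \<in> Cont X L \<alpha>"
    using \<open>(z, x) \<in> _\<close> by (simp add: Cont_rel_def)
  ultimately show ?thesis
    by (auto simp: Cont_rel_def)
qed

end

section \<open>Tail sums of an admissible weight function\<close>

locale admissible_greedoid = interval_greedoid X L for X :: "'a set" and L +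
  fixes k :: nat and q :: "'a list \<Rightarrow> real" and c :: "nat \<Rightarrow> real" and \<omega> :: "'a list \<Rightarrow> real"
  defines "\<omega> \<equiv> \<lambda>\<alpha>. zero_ext L q \<alpha> / c (length \<alpha>)"
  assumes k_less_rk: "k < rk L"
    and q_pos: "\<alpha> \<in> L \<Longrightarrow> q \<alpha> > 0"
    and c_pos: "i \<le> rk L \<Longrightarrow> c i > 0"
    and cont_inv: "\<alpha> \<in> L \<Longrightarrow> length \<alpha> < k \<Longrightarrow> ContInv X L (zero_ext L q) \<alpha>"
    and pa_mon: "\<alpha> \<in> L \<Longrightarrow> length \<alpha> < k \<Longrightarrow> PAMon X L (zero_ext L q) \<alpha>"
    and log_mod: "\<alpha> \<in> L \<Longrightarrow> length \<alpha> < k \<Longrightarrow> LogMod X L \<omega> \<alpha>"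
    and few_des: "\<alpha> \<in> L \<Longrightarrow> length \<alpha> < k \<Longrightarrow> FewDes X L \<alpha>"
    and syn_mon: "\<alpha> \<in> L \<Longrightarrow> length \<alpha> < k \<Longrightarrow> SynMon X L \<omega> \<alpha>"
    and scale_mon: "\<alpha> \<in> L \<Longrightarrow> length \<alpha> < k \<Longrightarrow> ScaleMon X L c \<omega> \<alpha>"
begin

definition tail :: "nat \<Rightarrow> 'a list \<Rightarrow> real" where
  "tail n \<alpha> = Lsum_at X L q \<alpha> n"

lemma tail_eq_Conts: "tail n \<alpha> = (\<Sum>\<beta>\<in>Conts X L n \<alpha>. zero_ext L q (\<alpha> @ \<beta>))"
  unfolding tail_def Lsum_at_def by (intro sum.cong) (auto simp: Conts_def zero_ext_def)

lemma finite_words_length: "finite {\<beta> \<in> lists X. length \<beta> = n}"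
  using finite_lists_length_eq[OF finite_ground, of n] by (simp add: lists_eq_set)

text \<open>With the zero extension the index set is independent of \<alpha>, so tails of different
  words can be compared term by term.\<close>

lemma tail_eq: "tail n \<alpha> = (\<Sum>\<beta> | \<beta> \<in> lists X \<and> length \<beta> = n. zero_ext L q (\<alpha> @ \<beta>))"
  unfolding tail_eq_Conts using finite_words_length hereditary
  by (intro sum.mono_neutral_left) (auto simp: Conts_def zero_ext_def)

lemma tail_notin: "\<alpha> \<notin> L \<Longrightarrow> tail n \<alpha> = 0"
  by (simp add: tail_def Lsum_at_def Conts_def)

lemma tail_0: "\<alpha> \<in> L \<Longrightarrow> tail 0 \<alpha> = q \<alpha>"
proof -
  assume "\<alpha> \<in> L"
  then have "Conts X L 0 \<alpha> = {[]}"
    by (auto simp: Conts_def)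
  then show ?thesis
    by (simp add: tail_def Lsum_at_def)
qed

lemma tail_nonneg: "tail n \<alpha> \<ge> 0"
  unfolding tail_def Lsum_at_def using q_pos
  by (intro sum_nonneg) (auto simp: Conts_def less_imp_le)

lemma tail_Suc: "tail (Suc n) \<alpha> = (\<Sum>x\<in>Cont X L \<alpha>. tail n (\<alpha> @ [x]))"
proof -
  have "bij_betw (\<lambda>(x, \<beta>). x # \<beta>) (X \<times> {\<beta> \<in> lists X. length \<beta> = n}) {\<beta> \<in> lists X. length \<beta> = Suc n}"
    by (auto simp: bij_betw_def inj_on_def length_Suc_conv image_iff)
  then have "tail (Suc n) \<alpha> =
      (\<Sum>(x, \<beta>)\<in>X \<times> {\<beta> \<in> lists X. length \<beta> = n}. zero_ext L q (\<alpha> @ x # \<beta>))"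
    unfolding tail_eq by (subst sum.reindex_bij_betw[symmetric]) (auto simp: case_prod_unfold)
  also have "\<dots> = (\<Sum>x\<in>X. tail n (\<alpha> @ [x]))"
    by (simp add: sum.cartesian_product tail_eq)
  also have "\<dots> = (\<Sum>x\<in>Cont X L \<alpha>. tail n (\<alpha> @ [x]))"
    using finite_ground words_over by (intro sum.mono_neutral_right) (auto simp: Cont_iff tail_notin)
  finally show ?thesis .
qed

lemma tail_pos: "\<alpha> \<in> L \<Longrightarrow> length \<alpha> + n \<le> rk L \<Longrightarrow> tail n \<alpha> > 0"
proof (induction n arbitrary: \<alpha>)
  case 0
  then show ?case by (simp add: tail_0 q_pos)
next
  case (Suc n)
  then show ?case
    unfolding tail_Suc using Cont_nonempty finite_Cont
    by (intro sum_pos) (auto simp: Cont_iff)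
qed

lemma tail_swap:
  assumes "\<alpha> \<in> L" "length \<alpha> < k" "x \<in> Cont X L \<alpha>" "y \<in> Cont X L \<alpha>" "set \<beta> \<subseteq> X"
  shows "tail n (\<alpha> @ x # y # \<beta>) = tail n (\<alpha> @ y # x # \<beta>)"
  unfolding tail_eq
proof (intro sum.cong refl)
  fix \<gamma> assume "\<gamma> \<in> {\<gamma>. \<gamma> \<in> lists X \<and> length \<gamma> = n}"
  then have "\<beta> @ \<gamma> \<in> lists X"
    using assms(5) by auto
  then show "zero_ext L q ((\<alpha> @ x # y # \<beta>) @ \<gamma>) = zero_ext L q ((\<alpha> @ y # x # \<beta>) @ \<gamma>)"
    using cont_inv[OF assms(1,2)] assms(3,4) by (auto simp: ContInv_def)
qed

text \<open>Positivity of \<open>q\<close> on \<open>L\<close> lets \<open>tail 0\<close> detect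
  membership, so \<open>ContInv\<close> also yields a statement about words.\<close>

lemma word_swap:
  assumes "\<alpha> \<in> L" "length \<alpha> < k" "x \<in> Cont X L \<alpha>" "y \<in> Cont X L \<alpha>" "set \<beta> \<subseteq> X"
  shows "\<alpha> @ x # y # \<beta> \<in> L \<longleftrightarrow> \<alpha> @ y # x # \<beta> \<in> L"
  using tail_swap[OF assms, of 0] tail_0 tail_notin q_pos by (metis less_irrefl)

section \<open>Rows, pullbacks and the pullback inequality\<close>

text \<open>
  Vectors are indexed by \<open>'a option\<close>, with \<open>None\<close> as the null vertex. The letters that become
  available only after \<open>x\<close> (the set \<open>Des\<close>) inherit the coordinate of \<open>x\<close>.
\<close>

definition pull :: "'a list \<Rightarrow> 'a \<Rightarrow> ('a option \<Rightarrow> real) \<Rightarrow> 'a option \<Rightarrow> real" where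
  "pull \<alpha> x v i = (case i of None \<Rightarrow> v None
    | Some y \<Rightarrow> if y \<in> Cont X L \<alpha> then v (Some y) else v (Some x))"

lemma pull_simps [simp]:
  "pull \<alpha> x v None = v None"
  "pull \<alpha> x v (Some y) = (if y \<in> Cont X L \<alpha> then v (Some y) else v (Some x))"
  by (simp_all add: pull_def)

text \<open>The null row of the matrix at \<open>(\<alpha>, n)\<close> applied to \<open>v\<close>.
  The row of a letter \<open>x\<close> will be \<open>row n (\<alpha> @ [x])\<close> of the pulled
  back vector.\<close>

definition row :: "nat \<Rightarrow> 'a list \<Rightarrow> ('a option \<Rightarrow> real) \<Rightarrow> real" where
  "row n \<alpha> v = v None * tail n \<alpha> + (\<Sum>x\<in>Cont X L \<alpha>. v (Some x) * tail n (\<alpha> @ [x]))"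

lemma row_notin: "\<alpha> \<notin> L \<Longrightarrow> row n \<alpha> v = 0"
  by (simp add: row_def tail_notin Cont_notin)

text \<open>A letter following \<open>\<alpha> @ [x]\<close> is either already available at \<alpha>
  or a descent of \<open>x\<close>; as \<open>f\<close> vanishes at infeasible letters, the first
  group may be enlarged to all of \<open>Cont X L \<alpha>\<close>.\<close>

lemma sum_Cont_Des:
  assumes "x \<in> Cont X L \<alpha>" "\<And>y. \<alpha> @ [x, y] \<notin> L \<Longrightarrow> f y = 0"
  shows "(\<Sum>y\<in>Cont X L (\<alpha> @ [x]). f y) = (\<Sum>y\<in>Cont X L \<alpha>. f y) + (\<Sum>y\<in>Des X L \<alpha> x. f y)"
proof -
  have "(\<Sum>y\<in>Cont X L (\<alpha> @ [x]). f y) =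
      (\<Sum>y\<in>Cont X L (\<alpha> @ [x]) \<inter> Cont X L \<alpha>. f y) + (\<Sum>y\<in>Des X L \<alpha> x. f y)"
    unfolding Des_eq by (rule sum.Int_Diff[OF finite_Cont])
  also have "(\<Sum>y\<in>Cont X L (\<alpha> @ [x]) \<inter> Cont X L \<alpha>. f y) = (\<Sum>y\<in>Cont X L \<alpha>. f y)"
    using assms(2) by (intro sum.mono_neutral_left finite_Cont) (force simp: Cont_iff)+
  finally show ?thesis .
qed

text \<open>Descents carry the coordinate of \<open>x\<close>, so together they form the diagonal
  coefficient in the row of \<open>x\<close>.\<close>

lemma row_pull:
  assumes "x \<in> Cont X L \<alpha>"
  shows "row n (\<alpha> @ [x]) (pull \<alpha> x v) = v None * tail n (\<alpha> @ [x])
    + (\<Sum>y\<in>Cont X L \<alpha>. v (Some y) * tail n (\<alpha> @ [x, y]))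
    + v (Some x) * (\<Sum>y\<in>Des X L \<alpha> x. tail n (\<alpha> @ [x, y]))"
proof -
  have "(\<Sum>y\<in>Cont X L (\<alpha> @ [x]). pull \<alpha> x v (Some y) * tail n (\<alpha> @ [x, y])) =
      (\<Sum>y\<in>Cont X L \<alpha>. pull \<alpha> x v (Some y) * tail n (\<alpha> @ [x, y])) +
      (\<Sum>y\<in>Des X L \<alpha> x. pull \<alpha> x v (Some y) * tail n (\<alpha> @ [x, y]))"
    by (rule sum_Cont_Des[OF assms]) (simp add: tail_notin)
  also have "(\<Sum>y\<in>Des X L \<alpha> x. pull \<alpha> x v (Some y) * tail n (\<alpha> @ [x, y])) =
      v (Some x) * (\<Sum>y\<in>Des X L \<alpha> x. tail n (\<alpha> @ [x, y]))"
    unfolding sum_distrib_left by (intro sum.cong) (auto simp: Des_eq)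
  also have "(\<Sum>y\<in>Cont X L \<alpha>. pull \<alpha> x v (Some y) * tail n (\<alpha> @ [x, y])) =
      (\<Sum>y\<in>Cont X L \<alpha>. v (Some y) * tail n (\<alpha> @ [x, y]))"
    by (intro sum.cong) auto
  finally show ?thesis
    by (simp add: row_def)
qed

text \<open>Splitting tails by their next letter gives descent terms, which agree on both sides, and
  a double sum over \<open>Cont X L \<alpha>\<close>, whose two orders agree by
  \<open>tail_swap\<close>.\<close>

lemma row_Suc:
  assumes "\<alpha> \<in> L" "length \<alpha> < k"
  shows "row (Suc n) \<alpha> v = (\<Sum>x\<in>Cont X L \<alpha>. row n (\<alpha> @ [x]) (pull \<alpha> x v))"
proof -
  let ?C = "Cont X L \<alpha>"
  have "tail (Suc n) (\<alpha> @ [x]) =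
      (\<Sum>y\<in>?C. tail n (\<alpha> @ [x, y])) + (\<Sum>y\<in>Des X L \<alpha> x. tail n (\<alpha> @ [x, y]))" if "x \<in> ?C" for x
    using sum_Cont_Des[OF that, of "\<lambda>y. tail n (\<alpha> @ [x, y])"] by (simp add: tail_Suc tail_notin)
  then have "row (Suc n) \<alpha> v = v None * (\<Sum>x\<in>?C. tail n (\<alpha> @ [x]))
      + (\<Sum>x\<in>?C. \<Sum>y\<in>?C. v (Some x) * tail n (\<alpha> @ [x, y]))
      + (\<Sum>x\<in>?C. v (Some x) * (\<Sum>y\<in>Des X L \<alpha> x. tail n (\<alpha> @ [x, y])))"
    by (simp add: row_def tail_Suc[of n \<alpha>] distrib_left sum.distrib sum_distrib_left cong: sum.cong)
  also have "(\<Sum>x\<in>?C. \<Sum>y\<in>?C. v (Some x) * tail n (\<alpha> @ [x, y])) =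
      (\<Sum>y\<in>?C. \<Sum>x\<in>?C. v (Some x) * tail n (\<alpha> @ [x, y]))"
    by (rule sum.swap)
  also have "\<dots> = (\<Sum>y\<in>?C. \<Sum>x\<in>?C. v (Some x) * tail n (\<alpha> @ [y, x]))"
    by (intro sum.cong refl) (simp add: tail_swap[OF assms])
  finally show ?thesis
    by (simp add: row_pull sum.distrib sum_distrib_left cong: sum.cong)
qed

text \<open>The quadratic form of the matrix \<open>atlas n \<alpha>\<close> below, written without its entries.\<close>

definition quad :: "nat \<Rightarrow> 'a list \<Rightarrow> ('a option \<Rightarrow> real) \<Rightarrow> real" where
  "quad n \<alpha> v = v None * row n \<alpha> v
    + (\<Sum>x\<in>Cont X L \<alpha>. v (Some x) * row n (\<alpha> @ [x]) (pull \<alpha> x v))"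

text \<open>
  The coordinates at \<open>z\<close> of the two iterated pullbacks differ only if \<open>z\<close> is passive or active for
  \<open>x\<close> and \<open>y\<close>, by \<open>v y - v x\<close> and by its negative, respectively. Here \<open>PAMon\<close> is used.
\<close>

lemma row_pull_pull_diff:
  assumes \<alpha>: "\<alpha> \<in> L" "length \<alpha> < k" and x: "x \<in> Cont X L \<alpha>" and y: "y \<in> Cont X L \<alpha>"
  shows "(v (Some y) - v (Some x)) *
    (row n (\<alpha> @ [x, y]) (pull (\<alpha> @ [x]) y (pull \<alpha> x v))
      - row n (\<alpha> @ [y, x]) (pull (\<alpha> @ [y]) x (pull \<alpha> y v))) \<ge> 0"
proof (cases "x \<noteq> y \<and> \<alpha> @ [x, y] \<in> L")
  case False
  then show ?thesis
    using word_swap[OF \<alpha> x y, of "[]"] row_notin by auto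
next
  case True
  let ?v = "\<lambda>x. v (Some x)"
  let ?p = "\<lambda>x y. pull (\<alpha> @ [x]) y (pull \<alpha> x v)"
  let ?Z = "Cont X L (\<alpha> @ [x, y])"
  have ZX: "?Z \<subseteq> X"
    using words_over by (auto simp: Cont_iff)
  have Z_eq: "Cont X L (\<alpha> @ [y, x]) = ?Z"
    using word_swap[OF \<alpha> x y] words_over by (force simp: Cont_iff)
  \<comment> \<open>The interval property: letters already available at \<alpha> stay available in
    between, so both pullbacks keep their own coordinate.\<close>
  have mid: "\<alpha> @ [u, z] \<in> L"
    if uw: "u \<in> Cont X L \<alpha>" and z: "\<alpha> @ [z] \<in> L" "\<alpha> @ [u, w, z] \<in> L" for u w z
  proof -
    have "\<alpha> @ [u, w, z] \<in> lists X"
      using z(2) words_over by blast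
    then show ?thesis
      using interval[of \<alpha> "[u]" "[w]" z] z by simp
  qed
  have diff: "?p x y (Some z) - ?p y x (Some z) =
      (?v y - ?v x) * (of_bool (z \<in> Pas X L \<alpha> x y) - of_bool (z \<in> Act X L \<alpha> x y))"
    if z: "z \<in> ?Z" for z
  proof -
    have "\<alpha> @ [x, y, z] \<in> L" "\<alpha> @ [y, x, z] \<in> L" "z \<in> X"
      using z Z_eq ZX by (auto simp: Cont_iff)
    then show ?thesis
      using mid[OF x, of z y] mid[OF y, of z x] x y
      by (auto simp: Cont_iff Pas_def Act_def)
  qed
  have tail_eq': "tail n (\<alpha> @ [y, x, z]) = tail n (\<alpha> @ [x, y, z])" if "z \<in> ?Z" for z
    using tail_swap[OF \<alpha> x y, of "[z]"] that ZX by auto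
  have "row n (\<alpha> @ [x, y]) (?p x y) - row n (\<alpha> @ [y, x]) (?p y x) =
      (\<Sum>z\<in>?Z. (?p x y (Some z) - ?p y x (Some z)) * tail n (\<alpha> @ [x, y, z]))"
    using tail_swap[OF \<alpha> x y, of "[]" n] unfolding row_def Z_eq
    by (simp add: tail_eq' sum_subtractf left_diff_distrib del: pull_simps(2) cong: sum.cong)
  also have "\<dots> = (\<Sum>z\<in>?Z. (?v y - ?v x) *
      (of_bool (z \<in> Pas X L \<alpha> x y) * tail n (\<alpha> @ [x, y, z])
        - of_bool (z \<in> Act X L \<alpha> x y) * tail n (\<alpha> @ [x, y, z])))"
    by (intro sum.cong refl) (simp only: diff mult.assoc left_diff_distrib)
  also have "\<dots> = (?v y - ?v x) *
      ((\<Sum>z\<in>?Z. of_bool (z \<in> Pas X L \<alpha> x y) * tail n (\<alpha> @ [x, y, z]))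
        - (\<Sum>z\<in>?Z. of_bool (z \<in> Act X L \<alpha> x y) * tail n (\<alpha> @ [x, y, z])))"
    by (simp only: sum_distrib_left[symmetric] sum_subtractf)
  also have "(\<Sum>z\<in>?Z. of_bool (z \<in> Pas X L \<alpha> x y) * tail n (\<alpha> @ [x, y, z])) =
      (\<Sum>z\<in>Pas X L \<alpha> x y. tail n (\<alpha> @ [x, y, z]))"
    by (intro sum.mono_neutral_cong_right finite_Cont) (auto simp: Pas_def Cont_iff)
  also have "(\<Sum>z\<in>?Z. of_bool (z \<in> Act X L \<alpha> x y) * tail n (\<alpha> @ [x, y, z])) =
      (\<Sum>z\<in>Act X L \<alpha> x y. tail n (\<alpha> @ [x, y, z]))"
    by (intro sum.mono_neutral_cong_right finite_Cont) (auto simp: Act_def Cont_iff)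
  finally have eq: "row n (\<alpha> @ [x, y]) (?p x y) - row n (\<alpha> @ [y, x]) (?p y x) =
      (?v y - ?v x) * ((\<Sum>z\<in>Pas X L \<alpha> x y. tail n (\<alpha> @ [x, y, z]))
        - (\<Sum>z\<in>Act X L \<alpha> x y. tail n (\<alpha> @ [x, y, z])))" .
  \<comment> \<open>This is \<open>PAMon\<close> at \<open>r = n\<close>; by \<open>eq\<close> the
    claimed product is a square times a nonnegative difference.\<close>
  have "(\<Sum>z\<in>Act X L \<alpha> x y. tail n (\<alpha> @ [x, y, z])) \<le> (\<Sum>z\<in>Pas X L \<alpha> x y. tail n (\<alpha> @ [x, y, z]))"
    unfolding tail_eq_Conts using pa_mon[OF \<alpha>] x y True by (simp add: PAMon_def)
  then show ?thesis
    unfolding eq mult.assoc[symmetric] by simp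
qed

text \<open>Expanding both sides by letters leaves a sum over pairs \<open>x\<close>,
  \<open>y\<close>; averaged with its transpose, it has the nonnegative terms of
  \<open>row_pull_pull_diff\<close>. The bound on the length allows \<open>row_Suc\<close> at the
  words \<open>\<alpha> @ [x]\<close>.\<close>

lemma quad_Suc_le:
  assumes \<alpha>: "\<alpha> \<in> L" "Suc (length \<alpha>) < k"
  shows "quad (Suc n) \<alpha> v \<le> (\<Sum>x\<in>Cont X L \<alpha>. quad n (\<alpha> @ [x]) (pull \<alpha> x v))"
proof -
  let ?C = "Cont X L \<alpha>" and ?v = "\<lambda>x. v (Some x)"
  define R where "R x y = row n (\<alpha> @ [x, y]) (pull (\<alpha> @ [x]) y (pull \<alpha> x v))" for x y
  have lt: "length \<alpha> < k" using \<alpha> by simp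
  define D where "D = (\<Sum>x\<in>?C. \<Sum>y\<in>?C. (?v y - ?v x) * R x y)"
  have R0: "R x y = 0" if "\<alpha> @ [x, y] \<notin> L" for x y
    using that by (simp add: R_def row_notin)
  have rS: "row (Suc n) (\<alpha> @ [x]) (pull \<alpha> x v) = (\<Sum>y\<in>Cont X L (\<alpha> @ [x]). R x y)" if "x \<in> ?C" for x
    using row_Suc[of "\<alpha> @ [x]" n "pull \<alpha> x v"] that \<alpha> by (simp add: Cont_iff R_def)
  have "(\<Sum>x\<in>?C. quad n (\<alpha> @ [x]) (pull \<alpha> x v)) =
      (\<Sum>x\<in>?C. v None * row n (\<alpha> @ [x]) (pull \<alpha> x v)
        + (\<Sum>y\<in>Cont X L (\<alpha> @ [x]). pull \<alpha> x v (Some y) * R x y))"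
    by (simp add: quad_def R_def del: pull_simps(2))
  also have "\<dots> = v None * row (Suc n) \<alpha> v
      + (\<Sum>x\<in>?C. \<Sum>y\<in>Cont X L (\<alpha> @ [x]). pull \<alpha> x v (Some y) * R x y)"
    by (simp add: row_Suc[OF \<alpha>(1) lt] sum.distrib sum_distrib_left del: pull_simps(2))
  finally have "(\<Sum>x\<in>?C. quad n (\<alpha> @ [x]) (pull \<alpha> x v)) - quad (Suc n) \<alpha> v =
      (\<Sum>x\<in>?C. \<Sum>y\<in>Cont X L (\<alpha> @ [x]). pull \<alpha> x v (Some y) * R x y)
      - (\<Sum>x\<in>?C. ?v x * (\<Sum>y\<in>Cont X L (\<alpha> @ [x]). R x y))"
    by (simp add: quad_def rS del: pull_simps(2) cong: sum.cong)
  also have "\<dots> = (\<Sum>x\<in>?C. \<Sum>y\<in>Cont X L (\<alpha> @ [x]). (pull \<alpha> x v (Some y) - ?v x) * R x y)"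
    by (simp only: left_diff_distrib sum_subtractf sum_distrib_left)
  also have "\<dots> = D"
    unfolding D_def
  proof (rule sum.cong[OF refl])
    fix x assume x: "x \<in> ?C"
    have "(\<Sum>y\<in>Cont X L (\<alpha> @ [x]). (pull \<alpha> x v (Some y) - ?v x) * R x y) =
        (\<Sum>y\<in>?C. (pull \<alpha> x v (Some y) - ?v x) * R x y) +
        (\<Sum>y\<in>Des X L \<alpha> x. (pull \<alpha> x v (Some y) - ?v x) * R x y)"
      by (rule sum_Cont_Des[OF x]) (simp add: R0)
    \<comment> \<open>A descent of \<open>x\<close> has the coordinate of \<open>x\<close> after the
      pullback.\<close>
    also have "(\<Sum>y\<in>Des X L \<alpha> x. (pull \<alpha> x v (Some y) - ?v x) * R x y) = 0"
      by (intro sum.neutral) (auto simp: Des_eq)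
    finally show "(\<Sum>y\<in>Cont X L (\<alpha> @ [x]). (pull \<alpha> x v (Some y) - ?v x) * R x y) =
        (\<Sum>y\<in>?C. (?v y - ?v x) * R x y)"
      by simp
  qed
  finally have eq: "(\<Sum>x\<in>?C. quad n (\<alpha> @ [x]) (pull \<alpha> x v)) - quad (Suc n) \<alpha> v = D" .
  have "D = (\<Sum>x\<in>?C. \<Sum>y\<in>?C. (?v x - ?v y) * R y x)"
    unfolding D_def by (rule sum.swap)
  then have "2 * D = (\<Sum>x\<in>?C. \<Sum>y\<in>?C. (?v y - ?v x) * R x y) + (\<Sum>x\<in>?C. \<Sum>y\<in>?C. (?v x - ?v y) * R y x)"
    using D_def by simp
  also have "\<dots> = (\<Sum>x\<in>?C. \<Sum>y\<in>?C. (?v y - ?v x) * (R x y - R y x))"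
    unfolding sum.distrib[symmetric] by (intro sum.cong refl) (simp add: algebra_simps)
  finally have "D = (\<Sum>x\<in>?C. \<Sum>y\<in>?C. (?v y - ?v x) * (R x y - R y x)) / 2"
    by simp
  moreover have "(\<Sum>x\<in>?C. \<Sum>y\<in>?C. (?v y - ?v x) * (R x y - R y x)) \<ge> 0"
    unfolding R_def using row_pull_pull_diff[OF \<alpha>(1) lt] by (intro sum_nonneg)
  ultimately show ?thesis
    using eq by simp
qed


section \<open>The combinatorial atlas\<close>

definition idx :: "'a list \<Rightarrow> 'a option set" where
  "idx \<alpha> = insert None (Some ` Cont X L \<alpha>)"

text \<open>The diagonal entry at \<open>x\<close> collects the descents of \<open>x\<close>, so
  that the letter columns of that row add up to
  \<open>tail (Suc n) (\<alpha> @ [x])\<close>.\<close>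

definition atlas :: "nat \<Rightarrow> 'a list \<Rightarrow> 'a option \<Rightarrow> 'a option \<Rightarrow> real" where
  "atlas n \<alpha> i j = (case i of
      None \<Rightarrow> (case j of None \<Rightarrow> tail n \<alpha> | Some y \<Rightarrow> tail n (\<alpha> @ [y]))
    | Some x \<Rightarrow> (case j of None \<Rightarrow> tail n (\<alpha> @ [x])
        | Some y \<Rightarrow> if x = y then \<Sum>z\<in>Des X L \<alpha> x. tail n (\<alpha> @ [x, z]) else tail n (\<alpha> @ [x, y])))"

definition const_vec :: "real \<Rightarrow> real \<Rightarrow> 'a option \<Rightarrow> real" where
  "const_vec s t i = (case i of None \<Rightarrow> s | Some x \<Rightarrow> t)"

lemma const_vec_simps [simp]: "const_vec s t None = s" "const_vec s t (Some x) = t"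
  by (simp_all add: const_vec_def)

lemma pull_const_vec: "pull \<alpha> x (const_vec s t) = const_vec s t"
  by (rule ext) (simp add: pull_def const_vec_def split: option.split)

lemma finite_idx: "finite (idx \<alpha>)"
  by (simp add: idx_def finite_Cont)

lemma sum_idx: "(\<Sum>i\<in>idx \<alpha>. f i) = f None + (\<Sum>x\<in>Cont X L \<alpha>. f (Some x))"
  by (simp add: idx_def finite_Cont sum.reindex image_iff)

lemma symmetric_atlas:
  assumes "\<alpha> \<in> L" "length \<alpha> < k"
  shows "symmetric_on (idx \<alpha>) (atlas n \<alpha>)"
  using tail_swap[OF assms, where \<beta> = "[]"]
  by (auto simp: symmetric_on_def idx_def atlas_def)

lemma atlas_nonneg: "atlas n \<alpha> i j \<ge> 0"
  by (auto simp: atlas_def tail_nonneg sum_nonneg split: option.split)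

lemma atlas_row_None: "(\<Sum>j\<in>idx \<alpha>. atlas n \<alpha> None j * v j) = row n \<alpha> v"
  by (simp add: sum_idx atlas_def row_def mult.commute)

lemma atlas_row_Some:
  assumes "x \<in> Cont X L \<alpha>"
  shows "(\<Sum>j\<in>idx \<alpha>. atlas n \<alpha> (Some x) j * v j) = row n (\<alpha> @ [x]) (pull \<alpha> x v)"
proof -
  let ?C = "Cont X L \<alpha>" and ?d = "\<Sum>z\<in>Des X L \<alpha> x. tail n (\<alpha> @ [x, z])"
  have "(\<Sum>y\<in>?C. (if x = y then ?d else tail n (\<alpha> @ [x, y])) * v (Some y)) =
      (\<Sum>y\<in>?C. v (Some y) * tail n (\<alpha> @ [x, y]) + (if x = y then v (Some y) * ?d else 0))"
    by (intro sum.cong refl) (simp add: tail_notin no_repeat)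
  also have "\<dots> = (\<Sum>y\<in>?C. v (Some y) * tail n (\<alpha> @ [x, y])) + v (Some x) * ?d"
    using assms finite_Cont by (simp add: sum.distrib)
  finally show ?thesis
    using assms by (simp add: sum_idx atlas_def row_pull)
qed

lemma bil_atlas:
  "bil (idx \<alpha>) (atlas n \<alpha>) v w = v None * row n \<alpha> w
    + (\<Sum>x\<in>Cont X L \<alpha>. v (Some x) * row n (\<alpha> @ [x]) (pull \<alpha> x w))"
  unfolding bil_def by (subst sum_idx) (simp add: atlas_row_None atlas_row_Some)

lemma bil_atlas_quad: "bil (idx \<alpha>) (atlas n \<alpha>) v v = quad n \<alpha> v"
  by (simp add: bil_atlas quad_def)

text \<open>Summing the letter rows raises the level by \<open>row_Suc\<close>. With
  \<open>row_const_vec\<close> this evaluates the form on the two indicator vectors as tails at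
  levels \<open>n\<close>, \<open>n + 1\<close>, \<open>n + 2\<close>.\<close>

lemma bil_atlas_const_vec:
  assumes "\<alpha> \<in> L" "length \<alpha> < k"
  shows "bil (idx \<alpha>) (atlas n \<alpha>) (const_vec s t) w = s * row n \<alpha> w + t * row (Suc n) \<alpha> w"
  by (simp add: bil_atlas row_Suc[OF assms] sum_distrib_left)

lemma row_const_vec: "row n \<alpha> (const_vec s t) = s * tail n \<alpha> + t * tail (Suc n) \<alpha>"
  by (simp add: row_def tail_Suc sum_distrib_left)

section \<open>Hyperbolicity of the atlas matrices and descent of their kernels\<close>

lemma tail_0_eq:
  assumes "length \<beta> \<le> rk L"
  shows "tail 0 \<beta> = c (length \<beta>) * \<omega> \<beta>"
  using c_pos[OF assms] by (simp add: \<omega>_def zero_ext_def tail_0 tail_notin)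

lemma omega_pos: "\<alpha> \<in> L \<Longrightarrow> length \<alpha> \<le> rk L \<Longrightarrow> \<omega> \<alpha> > 0"
  using c_pos q_pos by (simp add: \<omega>_def zero_ext_def)

text \<open>Orthogonality to the null vertex eliminates \<open>v None\<close>. In the coordinates
  \<open>w\<close>, \<open>LogMod\<close> makes the remaining form depend only on the class sums
  \<open>T D\<close> and their total \<open>S\<close>.\<close>

lemma hyperbolic_atlas_0:
  assumes \<alpha>: "\<alpha> \<in> L" "length \<alpha> < k"
  shows "hyperbolic (idx \<alpha>) (atlas 0 \<alpha>)"
proof (rule hyperbolicI[OF symmetric_atlas[OF \<alpha>], where g = "const_vec 1 0"])
  fix v assume "bil (idx \<alpha>) (atlas 0 \<alpha>) v (const_vec 1 0) = 0"
  then have row_0: "row 0 \<alpha> v = 0"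
    by (simp add: bil_commute[OF symmetric_atlas[OF \<alpha>], of _ v] bil_atlas_const_vec[OF \<alpha>])
  let ?C = "Cont X L \<alpha>" and ?P = "Par X L \<alpha>"
  define a where "a = \<omega> \<alpha>"
  define c0 where "c0 = c (length \<alpha>)"
  define c1 where "c1 = c (length \<alpha> + 1)"
  define c2 where "c2 = c (length \<alpha> + 2)"
  define u where "u x = \<omega> (\<alpha> @ [x])" for x
  define w where "w x = u x * v (Some x)" for x
  define b where "b = b_class X L \<omega> \<alpha>"
  define S where "S = (\<Sum>x\<in>?C. w x)"
  define T where "T D = (\<Sum>x\<in>D. w x)" for D
  define \<delta> where "\<delta> x = (\<Sum>y\<in>Des X L \<alpha> x. \<omega> (\<alpha> @ [x, y]))" for x
  have len: "length \<alpha> + 2 \<le> rk L"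
    using \<alpha> k_less_rk by simp
  have pos: "a > 0" "c0 > 0" "c1 > 0" "c2 > 0"
    using omega_pos[OF \<alpha>(1)] c_pos len by (auto simp: a_def c0_def c1_def c2_def)
  have u_pos: "u x > 0" if "x \<in> ?C" for x
    using that len omega_pos by (simp add: u_def Cont_iff)
  have tail1: "tail 0 (\<alpha> @ [x]) = c1 * u x" for x
    using len by (simp add: tail_0_eq c1_def u_def)
  have tail2: "tail 0 (\<alpha> @ [x, y]) = c2 * \<omega> (\<alpha> @ [x, y])" for x y
    using len by (simp add: tail_0_eq c2_def)
  have om2: "v (Some x) * v (Some y) * \<omega> (\<alpha> @ [x, y]) = w x * w y * of_bool (\<alpha> @ [x, y] \<in> L) / a"
    if "x \<in> ?C" "y \<in> ?C" for x y
  proof (cases "\<alpha> @ [x, y] \<in> L")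
    case True
    then have "u x * u y = a * \<omega> (\<alpha> @ [x, y])"
      using log_mod[OF \<alpha>] that by (simp add: LogMod_def u_def a_def)
    then show ?thesis
      using True pos by (simp add: w_def field_simps)
  next
    case False
    then show ?thesis by (simp add: \<omega>_def zero_ext_def)
  qed
  have "row 0 \<alpha> v = v None * (c0 * a) + c1 * S"
    using len by (simp add: row_def tail1 tail_0_eq[of \<alpha>] c0_def a_def S_def w_def sum_distrib_left ac_simps)
  then have v0: "v None = - (c1 * S) / (c0 * a)"
    using row_0 pos by (simp add: field_simps eq_neg_iff_add_eq_0)
  have row1: "row 0 (\<alpha> @ [x]) (pull \<alpha> x v) = v None * c1 * u x
      + c2 * (\<Sum>y\<in>?C. v (Some y) * \<omega> (\<alpha> @ [x, y])) + c2 * v (Some x) * \<delta> x" if "x \<in> ?C" for x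
    by (simp add: row_pull[OF that] tail1 tail2 \<delta>_def sum_distrib_left ac_simps)
  have "quad 0 \<alpha> v = (\<Sum>x\<in>?C. v None * c1 * w x
      + c2 * (\<Sum>y\<in>?C. v (Some x) * v (Some y) * \<omega> (\<alpha> @ [x, y])) + c2 * ((v (Some x))\<^sup>2 * \<delta> x))"
    unfolding quad_def row_0 mult_zero_right add_0
    by (intro sum.cong refl)
      (simp add: row1 w_def sum_distrib_left distrib_left power2_eq_square ac_simps)
  also have "\<dots> = v None * c1 * S + c2 * (\<Sum>x\<in>?C. \<Sum>y\<in>?C. w x * w y * of_bool (\<alpha> @ [x, y] \<in> L) / a)
      + c2 * (\<Sum>x\<in>?C. (v (Some x))\<^sup>2 * \<delta> x)"
    by (simp add: sum.distrib S_def sum_distrib_left om2 cong: sum.cong)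
  \<comment> \<open>Letters pair to a word exactly when their classes differ, so the sum is the
    square of the total minus the squares of the class sums.\<close>
  also have "(\<Sum>x\<in>?C. \<Sum>y\<in>?C. w x * w y * of_bool (\<alpha> @ [x, y] \<in> L) / a) =
      (S\<^sup>2 - (\<Sum>D\<in>?P. (T D)\<^sup>2)) / a"
  proof -
    have "(\<Sum>x\<in>?C. \<Sum>y\<in>?C. w x * w y * of_bool (\<alpha> @ [x, y] \<in> L)) =
        (\<Sum>D\<in>?P. \<Sum>x\<in>D. \<Sum>y\<in>?C. w x * w y * of_bool (\<alpha> @ [x, y] \<in> L))"
      by (rule sum_Par[symmetric])
    also have "\<dots> = (\<Sum>D\<in>?P. \<Sum>x\<in>D. w x * (S - T D))"
    proof (intro sum.cong[OF refl])
      fix D x assume D: "D \<in> ?P" "x \<in> D"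
      have "S = (\<Sum>y\<in>?C. w y * of_bool (\<alpha> @ [x, y] \<in> L)) + (\<Sum>y\<in>?C. w y * of_bool (\<alpha> @ [x, y] \<notin> L))"
        unfolding S_def sum.distrib[symmetric] by (intro sum.cong) auto
      also have "(\<Sum>y\<in>?C. w y * of_bool (\<alpha> @ [x, y] \<notin> L)) = T D"
        unfolding T_def
        by (intro sum.mono_neutral_cong_right finite_Cont) (auto simp: Par_eq[OF D])
      finally show "(\<Sum>y\<in>?C. w x * w y * of_bool (\<alpha> @ [x, y] \<in> L)) = w x * (S - T D)"
        by (simp add: mult.assoc sum_distrib_left[symmetric])
    qed
    also have "\<dots> = (\<Sum>D\<in>?P. T D) * S - (\<Sum>D\<in>?P. (T D)\<^sup>2)"
      by (simp add: sum_distrib_right[symmetric] T_def[symmetric] right_diff_distrib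
          sum_subtractf power2_eq_square)
    also have "(\<Sum>D\<in>?P. T D) = S"
      by (simp add: T_def S_def sum_Par)
    finally show ?thesis
      by (simp add: sum_divide_distrib[symmetric] power2_eq_square)
  qed
  \<comment> \<open>By \<open>FewDes\<close> only singleton classes have descents, and there
    \<open>T D\<close> is the single term \<open>w x\<close>.\<close>
  also have "(\<Sum>x\<in>?C. (v (Some x))\<^sup>2 * \<delta> x) = (\<Sum>D\<in>?P. b D * (T D)\<^sup>2) / a"
    unfolding sum_Par[symmetric] sum_divide_distrib
  proof (rule sum.cong[OF refl])
    fix D assume D: "D \<in> ?P"
    show "(\<Sum>x\<in>D. (v (Some x))\<^sup>2 * \<delta> x) = b D * (T D)\<^sup>2 / a"
    proof (cases "is_singleton D")
      case True
      then obtain x where x: "D = {x}" by (auto simp: is_singleton_def)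
      have "x \<in> ?C"
        using Par_eq[OF D, of x] x by blast
      moreover have "b D = a * \<delta> x / (u x)\<^sup>2"
        using x by (simp add: b_def b_class_def \<delta>_def a_def u_def sum_distrib_left sum_divide_distrib)
      ultimately show ?thesis
        using x u_pos[of x] pos by (simp add: T_def w_def field_simps power2_eq_square)
    next
      case False
      have "Des X L \<alpha> x = {}" if "x \<in> D" for x
      proof -
        have "finite D"
          using Par_eq[OF D that] finite_Cont by (auto intro: finite_subset)
        then have "card D \<noteq> 0" "card D \<noteq> 1"
          using that False by (auto simp: is_singleton_altdef)
        then show ?thesis
          using few_des[OF \<alpha>] D that by (simp add: FewDes_def)
      qed
      then show ?thesis
        using False by (simp add: \<delta>_def b_def b_class_def)
    qed
  qed
  finally have "quad 0 \<alpha> v = v None * c1 * S + c2 * ((S\<^sup>2 - (\<Sum>D\<in>?P. (T D)\<^sup>2)) / a)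
      + c2 * ((\<Sum>D\<in>?P. b D * (T D)\<^sup>2) / a)" .
  then have quad_eq: "quad 0 \<alpha> v = (c2 * S\<^sup>2 - c1\<^sup>2 * S\<^sup>2 / c0 - c2 * (\<Sum>D\<in>?P. (1 - b D) * (T D)\<^sup>2)) / a"
  proof (rule back_subst[of "\<lambda>x. quad 0 \<alpha> v = x"])
    have "v None * c1 * S = - (c1\<^sup>2 * S\<^sup>2 / c0) / a"
      using pos by (simp add: v0 power2_eq_square mult.commute)
    moreover have "(\<Sum>D\<in>?P. (1 - b D) * (T D)\<^sup>2) = (\<Sum>D\<in>?P. (T D)\<^sup>2) - (\<Sum>D\<in>?P. b D * (T D)\<^sup>2)"
      by (simp add: left_diff_distrib sum_subtractf)
    ultimately show "v None * c1 * S + c2 * ((S\<^sup>2 - (\<Sum>D\<in>?P. (T D)\<^sup>2)) / a)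
      + c2 * ((\<Sum>D\<in>?P. b D * (T D)\<^sup>2) / a) =
      (c2 * S\<^sup>2 - c1\<^sup>2 * S\<^sup>2 / c0 - c2 * (\<Sum>D\<in>?P. (1 - b D) * (T D)\<^sup>2)) / a"
      by (simp only:) (simp add: diff_divide_distrib add_divide_distrib algebra_simps)
  qed
  have b_le: "b D \<le> 1" if D: "D \<in> ?P" for D
  proof (cases "is_singleton D")
    case True
    then obtain x where x: "D = {x}" by (auto simp: is_singleton_def)
    have xC: "x \<in> ?C"
      using Par_eq[OF D, of x] x by blast
    then have "(\<Sum>y\<in>Des X L \<alpha> x. \<omega> \<alpha> * \<omega> (\<alpha> @ [x, y])) \<le> (\<omega> (\<alpha> @ [x]))\<^sup>2"
      using syn_mon[OF \<alpha>] by (simp add: SynMon_def)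
    then show ?thesis
      using x u_pos[OF xC] by (simp add: b_def b_class_def sum_divide_distrib[symmetric] u_def)
  next
    case False
    then show ?thesis by (simp add: b_def b_class_def)
  qed
  have "(1 - c1\<^sup>2 / (c0 * c2)) * S\<^sup>2 \<le> (\<Sum>D\<in>?P. (1 - b D) * (T D)\<^sup>2)" (is "?e * _ \<le> ?U")
  proof (cases "c1\<^sup>2 < c0 * c2")
    case True
    then have less: "b D < 1" if "D \<in> ?P" for D
      using scale_mon[OF \<alpha>] that by (auto simp: ScaleMon_def Let_def c0_def c1_def c2_def b_def)
    have scale: "?e * (\<Sum>D\<in>?P. 1 / (1 - b D)) \<le> 1"
      using scale_mon[OF \<alpha>] True by (auto simp: ScaleMon_def Let_def c0_def c1_def c2_def b_def)
    \<comment> \<open>Split for Cauchy-Schwarz so that the first factor is the sum bounded by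
      \<open>ScaleMon\<close>.\<close>
    have "S = (\<Sum>D\<in>?P. 1 / sqrt (1 - b D) * (sqrt (1 - b D) * T D))"
      unfolding S_def sum_Par[symmetric] T_def[symmetric]
      by (intro sum.cong refl) (use less in fastforce)
    then have "S\<^sup>2 \<le> (\<Sum>D\<in>?P. (1 / sqrt (1 - b D))\<^sup>2) * (\<Sum>D\<in>?P. (sqrt (1 - b D) * T D)\<^sup>2)"
      using Cauchy_Schwarz_ineq_sum[of "\<lambda>D. 1 / sqrt (1 - b D)" "\<lambda>D. sqrt (1 - b D) * T D" ?P] by simp
    also have "\<dots> = (\<Sum>D\<in>?P. 1 / (1 - b D)) * ?U"
      using less by (simp add: power_divide power_mult_distrib less_imp_le cong: sum.cong)
    finally have "?e * S\<^sup>2 \<le> ?e * (\<Sum>D\<in>?P. 1 / (1 - b D)) * ?U"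
      using True pos by (simp add: mult_left_mono mult.assoc)
    also have "\<dots> \<le> ?U"
      using mult_right_mono[OF scale, of ?U] b_le by (simp add: sum_nonneg)
    finally show ?thesis .
  next
    case False
    \<comment> \<open>Here the left coefficient is nonpositive, and \<open>SynMon\<close>, through
      \<open>b_le\<close>, makes the right side nonnegative.\<close>
    then have "?e * S\<^sup>2 \<le> 0"
      using pos by (intro mult_nonpos_nonneg) (simp_all add: field_simps)
    also have "0 \<le> ?U"
      using b_le by (intro sum_nonneg) simp
    finally show ?thesis .
  qed
  then have "c2 * (?e * S\<^sup>2) \<le> c2 * ?U"
    using pos by simp
  moreover have "c2 * (?e * S\<^sup>2) = c2 * S\<^sup>2 - c1\<^sup>2 * S\<^sup>2 / c0"
    using pos by (simp add: field_simps)
  ultimately show "bil (idx \<alpha>) (atlas 0 \<alpha>) v v \<le> 0"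
    unfolding bil_atlas_quad quad_eq using pos by (simp add: divide_le_0_iff)
qed

text \<open>For the mixed matrix, rows are pairings with \<open>h\<close> in the forms at \<alpha>
  and \<open>\<alpha> @ [x]\<close> at level \<open>n\<close>. Hyperbolicity of these forms and
  \<open>quad_Suc_le\<close> give the last assumption of \<open>perron_hyperbolic\<close>; then
  \<open>t\<close> tends to \<open>1\<close>.\<close>

lemma hyperbolic_atlas:
  assumes "\<alpha> \<in> L" "length \<alpha> + n < k"
  shows "hyperbolic (idx \<alpha>) (atlas n \<alpha>)"
  using assms
proof (induction n arbitrary: \<alpha>)
  case 0
  then show ?case by (simp add: hyperbolic_atlas_0)
next
  case (Suc n)
  note \<alpha> = Suc.prems(1)
  have lt: "length \<alpha> < k"
    using Suc.prems by simp
  \<comment> \<open>A Perron vector must be positive at the null vertex, so \<open>atlas n \<alpha>\<close> is mixed in.\<close>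
  show ?case
  proof (rule hyperbolic_limit[where N = "atlas n \<alpha>"])
    fix t :: real assume t: "0 < t" "t < 1"
    let ?M = "\<lambda>i j. t * atlas (Suc n) \<alpha> i j + (1 - t) * atlas n \<alpha> i j"
    let ?B = "\<lambda>\<beta>. bil (idx \<beta>) (atlas n \<beta>)"
    \<comment> \<open>The mixing weights of \<open>?M\<close> reappear as coordinates, so that
      \<open>bil_atlas_const_vec\<close> turns rows of \<open>?M\<close> into pairings with
      \<open>h\<close>.\<close>
    define h where "h = const_vec (1 - t) t"
    have h_None: "h None = 1 - t" and h_Some: "h (Some x) = t" for x
      by (simp_all add: h_def)
    have pull_h: "pull \<alpha> x h = h" for x
      by (simp add: h_def pull_const_vec)
    have M_row: "(\<Sum>j\<in>idx \<alpha>. ?M i j * v j) =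
        t * (\<Sum>j\<in>idx \<alpha>. atlas (Suc n) \<alpha> i j * v j) + (1 - t) * (\<Sum>j\<in>idx \<alpha>. atlas n \<alpha> i j * v j)" for i v
      by (simp add: distrib_right sum.distrib sum_distrib_left mult.assoc)
    have M_None: "(\<Sum>j\<in>idx \<alpha>. ?M None j * v j) = ?B \<alpha> h v" for v
      unfolding M_row atlas_row_None h_def bil_atlas_const_vec[OF \<alpha> lt] by simp
    have M_Some: "(\<Sum>j\<in>idx \<alpha>. ?M (Some x) j * v j) = ?B (\<alpha> @ [x]) h (pull \<alpha> x v)"
      if "x \<in> Cont X L \<alpha>" for x v
    proof -
      have "\<alpha> @ [x] \<in> L" "length (\<alpha> @ [x]) < k"
        using that Suc.prems by (simp_all add: Cont_iff)
      then show ?thesis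
        unfolding M_row atlas_row_Some[OF that] h_def by (simp add: bil_atlas_const_vec)
    qed
    have hyp: "(?B \<beta> v v) \<le> (?B \<beta> h v)\<^sup>2 / ?B \<beta> h h"
      if \<beta>: "\<beta> \<in> L" "length \<beta> + n < k" and IH: "hyperbolic (idx \<beta>) (atlas n \<beta>)" for \<beta> v
    proof -
      have \<beta>k: "length \<beta> < k"
        using \<beta> by simp
      have "tail n \<beta> > 0"
        using \<beta> k_less_rk by (intro tail_pos) auto
      then have "?B \<beta> h h > 0"
        using t unfolding h_def bil_atlas_const_vec[OF \<beta>(1) \<beta>k] row_const_vec
        by (intro add_pos_nonneg mult_pos_pos mult_nonneg_nonneg add_nonneg_nonneg)
          (auto simp: tail_nonneg)
      moreover from this have "?B \<beta> v v * ?B \<beta> h h \<le> (?B \<beta> v h)\<^sup>2"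
        using IH by (simp add: hyperbolic_def)
      ultimately show ?thesis
        using bil_commute[OF symmetric_atlas[OF \<beta>(1) \<beta>k]] by (simp add: pos_le_divide_eq)
    qed
    show "hyperbolic (idx \<alpha>) ?M"
    proof (rule perron_hyperbolic[where e = None and h = h])
      show "finite (idx \<alpha>)" by (rule finite_idx)
      show "symmetric_on (idx \<alpha>) ?M"
        using symmetric_atlas[OF \<alpha> lt] by (simp add: symmetric_on_def)
      show "?M i j \<ge> 0" for i j
        using t by (simp add: atlas_nonneg)
      show "None \<in> idx \<alpha>" by (simp add: idx_def)
      show "?M None j > 0" if "j \<in> idx \<alpha>" for j
      proof -
        have "atlas n \<alpha> None j > 0"
          using that Suc.prems k_less_rk by (auto simp: idx_def atlas_def Cont_iff intro!: tail_pos)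
        then show ?thesis
          using t by (intro add_nonneg_pos) (auto simp: atlas_nonneg)
      qed
      show "h i > 0" for i
        using t by (cases i) (simp_all add: h_def)
      show "bil (idx \<alpha>) ?M v v \<le>
          (\<Sum>i\<in>idx \<alpha>. h i * (\<Sum>j\<in>idx \<alpha>. ?M i j * v j)\<^sup>2 / (\<Sum>j\<in>idx \<alpha>. ?M i j * h j))" for v
      proof -
        have "bil (idx \<alpha>) ?M v v = t * quad (Suc n) \<alpha> v + (1 - t) * quad n \<alpha> v"
          by (simp add: bil_linear_matrix bil_atlas_quad)
        also have "\<dots> \<le> t * (\<Sum>x\<in>Cont X L \<alpha>. quad n (\<alpha> @ [x]) (pull \<alpha> x v)) + (1 - t) * quad n \<alpha> v"
          using t Suc.prems by (simp add: quad_Suc_le)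
        also have "\<dots> \<le> t * (\<Sum>x\<in>Cont X L \<alpha>. (?B (\<alpha> @ [x]) h (pull \<alpha> x v))\<^sup>2 / ?B (\<alpha> @ [x]) h h)
            + (1 - t) * ((?B \<alpha> h v)\<^sup>2 / ?B \<alpha> h h)"
          using t Suc unfolding bil_atlas_quad[symmetric]
          by (intro add_mono mult_left_mono sum_mono hyp) (auto simp: Cont_iff)
        finally show ?thesis
          using sum_idx[of "\<lambda>i. h i * (\<Sum>j\<in>idx \<alpha>. ?M i j * v j)\<^sup>2 / (\<Sum>j\<in>idx \<alpha>. ?M i j * h j)" \<alpha>]
          by (simp add: M_None M_Some pull_h h_None h_Some sum_distrib_left cong: sum.cong)
      qed
    qed
  qed
qed

text \<open>Every form at \<open>\<alpha> @ [y]\<close> is nonpositive at \<open>?z\<close>, which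
  is orthogonal to a positive vector, while by \<open>quad_Suc_le\<close> their sum is at least
  \<open>0\<close>. So each value vanishes and \<open>hyperbolic_kernel\<close> applies;
  \<open>pull\<close> fixes \<open>?z\<close>, which keeps \<open>s\<close> and
  \<open>t\<close>.\<close>

lemma kernel_descends:
  assumes \<alpha>: "\<alpha> \<in> L" "length \<alpha> + Suc n < k" and x: "x \<in> Cont X L \<alpha>"
    and ker: "\<And>u. bil (idx \<alpha>) (atlas (Suc n) \<alpha>) u (const_vec s t) = 0"
  shows "bil (idx (\<alpha> @ [x])) (atlas n (\<alpha> @ [x])) u (const_vec s t) = 0"
proof -
  let ?z = "const_vec s t"
  let ?B = "\<lambda>y. bil (idx (\<alpha> @ [y])) (atlas n (\<alpha> @ [y]))"
  have \<alpha>y: "\<alpha> @ [y] \<in> L" "length (\<alpha> @ [y]) < k" "length (\<alpha> @ [y]) + n < k" if "y \<in> Cont X L \<alpha>" for y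
    using that \<alpha> by (simp_all add: Cont_iff)
  have row_z: "row (Suc n) (\<alpha> @ [y]) ?z = 0" if y: "y \<in> Cont X L \<alpha>" for y
    using ker[of "\<lambda>i. of_bool (i = Some y)"] y finite_Cont
    by (simp add: bil_atlas pull_const_vec of_bool_def if_distrib[of "\<lambda>x. x * _"] cong: if_cong)
  \<comment> \<open>The value is \<open>tail (Suc (Suc n))\<close> at \<open>\<alpha> @ [y]\<close>,
    a sum over words of length at most \<open>k + 1\<close>, which is at most
    \<open>rk L\<close>.\<close>
  have w_pos: "?B y (const_vec 0 1) (const_vec 0 1) > 0" if y: "y \<in> Cont X L \<alpha>" for y
    using tail_pos[OF \<alpha>y(1)[OF y], of "Suc (Suc n)"] \<alpha> k_less_rk
    by (simp add: bil_atlas_const_vec[OF \<alpha>y(1,2)[OF y]] row_const_vec)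
  have w_perp: "?B y ?z (const_vec 0 1) = 0" if y: "y \<in> Cont X L \<alpha>" for y
    using row_z[OF y] bil_commute[OF symmetric_atlas[OF \<alpha>y(1,2)[OF y]]]
    by (simp add: bil_atlas_const_vec[OF \<alpha>y(1,2)[OF y]])
  have nonpos: "?B y ?z ?z \<le> 0" if y: "y \<in> Cont X L \<alpha>" for y
    using hyperbolic_nonpos[OF hyperbolic_atlas[OF \<alpha>y(1,3)[OF y]] w_pos[OF y] w_perp[OF y]] .
  have "0 = quad (Suc n) \<alpha> ?z"
    using ker by (simp add: bil_atlas_quad[symmetric])
  also have "\<dots> \<le> (\<Sum>y\<in>Cont X L \<alpha>. ?B y ?z ?z)"
    using quad_Suc_le[of \<alpha> n ?z] \<alpha> by (simp add: pull_const_vec bil_atlas_quad)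
  finally have "(\<Sum>y\<in>Cont X L \<alpha>. - ?B y ?z ?z) = 0"
    using nonpos sum_nonpos[of "Cont X L \<alpha>" "\<lambda>y. ?B y ?z ?z"] by (simp add: sum_negf)
  then have "?B x ?z ?z = 0"
    using x nonpos finite_Cont by (subst (asm) sum_nonneg_eq_0_iff) auto
  then show ?thesis
    using hyperbolic_kernel[OF symmetric_atlas[OF \<alpha>y(1,2)[OF x]] hyperbolic_atlas[OF \<alpha>y(1,3)[OF x]]
        w_pos[OF x] w_perp[OF x]] by blast
qed

section \<open>Level sums and the equality criterion\<close>

lemma sum_tail_Suc:
  "(\<Sum>\<alpha> | \<alpha> \<in> L \<and> length \<alpha> = m. tail (Suc n) \<alpha>) = (\<Sum>\<alpha> | \<alpha> \<in> L \<and> length \<alpha> = Suc m. tail n \<alpha>)"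
proof -
  let ?A = "\<lambda>m. {\<alpha>. \<alpha> \<in> L \<and> length \<alpha> = m}"
  have "bij_betw (\<lambda>(\<alpha>, x). \<alpha> @ [x]) (SIGMA \<alpha>:?A m. Cont X L \<alpha>) (?A (Suc m))"
    using hereditary
    by (auto simp: bij_betw_def inj_on_def Cont_iff image_iff length_Suc_conv_rev)
  then have "(\<Sum>\<alpha>\<in>?A (Suc m). tail n \<alpha>) = (\<Sum>(\<alpha>, x)\<in>(SIGMA \<alpha>:?A m. Cont X L \<alpha>). tail n (\<alpha> @ [x]))"
    by (subst sum.reindex_bij_betw[symmetric]) (auto simp: case_prod_unfold)
  also have "\<dots> = (\<Sum>\<alpha>\<in>?A m. tail (Suc n) \<alpha>)"
    using finite_words finite_Cont by (simp add: tail_Suc sum.Sigma)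
  finally show ?thesis by simp
qed

lemma sum_tail: "(\<Sum>\<alpha> | \<alpha> \<in> L \<and> length \<alpha> = m. tail n \<alpha>) = Lsum L q (m + n)"
proof (induction n arbitrary: m)
  case 0
  then show ?case by (simp add: Lsum_def tail_0)
next
  case (Suc n)
  then show ?case by (simp add: sum_tail_Suc)
qed

lemma Lsum_eq_tail: "Lsum L q n = tail n []"
proof -
  have "{\<alpha>. \<alpha> \<in> L \<and> length \<alpha> = 0} = {[]}"
    using nil_word by auto
  then show ?thesis
    using sum_tail[where m = 0] by simp
qed

lemma log_concavity_equality_iff:
  assumes "1 \<le> k"
  shows "(Lsum L q k)\<^sup>2 = Lsum L q (k - 1) * Lsum L q (k + 1) \<longleftrightarrow>
    (\<exists>s>0. \<forall>\<alpha>\<in>L. length \<alpha> = k - 1 \<longrightarrow> tail 2 \<alpha> = s * tail 1 \<alpha> \<and> s * tail 1 \<alpha> = s\<^sup>2 * tail 0 \<alpha>)"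
proof
  assume eq: "(Lsum L q k)\<^sup>2 = Lsum L q (k - 1) * Lsum L q (k + 1)"
  define n where "n = k - 1"
  have n: "Suc n = k" "n < k"
    using assms by (simp_all add: n_def)
  have tails: "tail n [] > 0" "tail (Suc n) [] > 0"
    using nil_word k_less_rk n by (auto intro!: tail_pos)
  have tail_eq: "(tail (Suc n) [])\<^sup>2 = tail n [] * tail (Suc (Suc n)) []"
    using eq by (simp add: Lsum_eq_tail n_def[symmetric] n(1)[symmetric])
  \<comment> \<open>This ratio makes \<open>z\<close> orthogonal to the null vertex; the assumed
    equality makes it isotropic.\<close>
  define s where "s = tail (Suc n) [] / tail n []"
  have s: "s > 0"
    using tails by (simp add: s_def)
  define z where "z = const_vec (- s) 1"
  let ?B = "bil (idx []) (atlas n [])"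
  have k0: "length ([] :: 'a list) < k"
    using n by simp
  note B_const = bil_atlas_const_vec[OF nil_word k0]
  have ker_nil: "?B u z = 0" for u
  proof (rule hyperbolic_kernel)
    show "symmetric_on (idx []) (atlas n [])"
      using symmetric_atlas[OF nil_word k0] .
    show "hyperbolic (idx []) (atlas n [])"
      using n by (intro hyperbolic_atlas nil_word) simp
    show "?B (const_vec 1 0) (const_vec 1 0) > 0" "?B z (const_vec 1 0) = 0" "?B z z = 0"
      using tails tail_eq
      by (simp_all add: z_def B_const row_const_vec s_def field_simps power2_eq_square)
  qed
  \<comment> \<open>Each added letter lowers the level by one, so words of length
    \<open>k - 1\<close> end at level \<open>0\<close>.\<close>
  have ker: "bil (idx \<alpha>) (atlas (n - length \<alpha>) \<alpha>) u z = 0" if "\<alpha> \<in> L" "length \<alpha> \<le> n" for \<alpha> u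
    using that
  proof (induction \<alpha> arbitrary: u rule: rev_induct)
    case Nil
    then show ?case by (simp add: ker_nil)
  next
    case (snoc x \<alpha>)
    then have "\<alpha> \<in> L" "x \<in> Cont X L \<alpha>" "n - length \<alpha> = Suc (n - length (\<alpha> @ [x]))"
      using hereditary by (auto simp: Cont_iff)
    then show ?case
      using snoc n unfolding z_def by (intro kernel_descends) auto
  qed
  show "\<exists>s>0. \<forall>\<alpha>\<in>L. length \<alpha> = k - 1 \<longrightarrow>
      tail 2 \<alpha> = s * tail 1 \<alpha> \<and> s * tail 1 \<alpha> = s\<^sup>2 * tail 0 \<alpha>"
  proof (intro exI[of _ s] conjI s ballI impI)
    fix \<alpha> assume \<alpha>: "\<alpha> \<in> L" "length \<alpha> = k - 1"
    then have lt: "length \<alpha> < k" and "length \<alpha> = n"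
      using n by simp_all
    then have "bil (idx \<alpha>) (atlas 0 \<alpha>) u z = 0" for u
      using ker[OF \<alpha>(1), of u] by simp
    \<comment> \<open>Pairing \<open>z\<close> with the null indicator and with the letter indicator
      gives the two ratios.\<close>
    from this[of "const_vec 1 0"] this[of "const_vec 0 1"]
    show "tail 2 \<alpha> = s * tail 1 \<alpha>" "s * tail 1 \<alpha> = s\<^sup>2 * tail 0 \<alpha>"
      unfolding z_def bil_atlas_const_vec[OF \<alpha>(1) lt] row_const_vec
      by (simp_all add: numeral_2_eq_2 power2_eq_square)
  qed
next
  assume "\<exists>s>0. \<forall>\<alpha>\<in>L. length \<alpha> = k - 1 \<longrightarrow>
    tail 2 \<alpha> = s * tail 1 \<alpha> \<and> s * tail 1 \<alpha> = s\<^sup>2 * tail 0 \<alpha>"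
  then obtain s where s: "s > 0"
    "\<And>\<alpha>. \<alpha> \<in> L \<Longrightarrow> length \<alpha> = k - 1 \<Longrightarrow> tail 2 \<alpha> = s * tail 1 \<alpha>"
    "\<And>\<alpha>. \<alpha> \<in> L \<Longrightarrow> length \<alpha> = k - 1 \<Longrightarrow> s * tail 1 \<alpha> = s\<^sup>2 * tail 0 \<alpha>"
    by blast
  have s1: "tail 1 \<alpha> = s * tail 0 \<alpha>" if "\<alpha> \<in> L" "length \<alpha> = k - 1" for \<alpha>
    using s(3)[OF that] s(1) by (simp add: power2_eq_square)
  \<comment> \<open>Summing over words of length \<open>k - 1\<close> makes the three level sums a
    geometric progression with ratio \<open>s\<close>.\<close>
  have "Lsum L q (k - 1 + 2) = s * Lsum L q (k - 1 + 1)" "Lsum L q (k - 1 + 1) = s * Lsum L q (k - 1 + 0)"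
    unfolding sum_tail[symmetric] sum_distrib_left using s(2) s1 by (auto intro!: sum.cong)
  then show "(Lsum L q k)\<^sup>2 = Lsum L q (k - 1) * Lsum L q (k + 1)"
    using assms by (simp add: power2_eq_square)
qed

end

theorem theorem1p33:
  fixes X :: "'a set" and L :: "'a list set" and k :: nat and q :: "'a list \<Rightarrow> real"
  assumes "interval_greedoid X L"
    and "1 \<le> k" and "k < rk L"
    and "\<forall>\<alpha>\<in>L. q \<alpha> > 0"
    and "admissible X L k q"
  shows "(Lsum L q k)\<^sup>2 = Lsum L q (k - 1) * Lsum L q (k + 1) \<longleftrightarrow>
    (\<exists>s>0. \<forall>\<alpha>\<in>L. length \<alpha> = k - 1 \<longrightarrow>
       Lsum_at X L q \<alpha> 2 = s * Lsum_at X L q \<alpha> 1 \<and>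
       s * Lsum_at X L q \<alpha> 1 = s\<^sup>2 * Lsum_at X L q \<alpha> 0)"
proof -
  obtain c :: "nat \<Rightarrow> real" where c: "\<forall>i\<le>rk L. c i > 0"
    "\<forall>\<alpha>\<in>L. length \<alpha> < k \<longrightarrow>
      ContInv X L (zero_ext L q) \<alpha> \<and> PAMon X L (zero_ext L q) \<alpha> \<and>
      LogMod X L (\<lambda>\<alpha>. zero_ext L q \<alpha> / c (length \<alpha>)) \<alpha> \<and> FewDes X L \<alpha> \<and>
      SynMon X L (\<lambda>\<alpha>. zero_ext L q \<alpha> / c (length \<alpha>)) \<alpha> \<and>
      ScaleMon X L c (\<lambda>\<alpha>. zero_ext L q \<alpha> / c (length \<alpha>)) \<alpha>"
    using assms(5) unfolding admissible_def Let_def by blast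
  interpret interval_greedoid X L by (rule assms(1))
  interpret admissible_greedoid X L k q c "\<lambda>\<alpha>. zero_ext L q \<alpha> / c (length \<alpha>)"
    using c assms(3,4) by unfold_locales auto
  show ?thesis
    using log_concavity_equality_iff[OF assms(2)] by (simp add: tail_def)
qed

end
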